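(* Let $r$ be an integer $\geq 1$ and let $f:(0,\infty)\to\mathbb{R}$. The function $x^r f(x)$ is completely monotonic if and only if $$f(x)=\int_0^\infty e^{-xt}\,p(t)\,dt,$$ where the integral converges for all $x>0$ and where $p$ is $r-1$ times differentiable on $[0,\infty)$ with $p^{(r-1)}(t)=\mu([0,t])$ for some Radon measure $\mu$ on $[0,\infty)$ and $p^{(k)}(0)=0$ for $0\leq k\leq r-2$.
   Context: A function $g:(0,\infty)\to\mathbb{R}$ is called completely monotonic if it has derivatives of all orders and satisfies $(-1)^n g^{(n)}(x)\geq 0$ for all $x>0$ and $n=0,1,2,\ldots$. Radon measures on $[0,\infty)$ are nonnegative. Here $p^{(k)}$ denotes the $k$-th derivative of $p$, with $p^{(0)}=p$.
   Formalization: For r ≥ 2 the formula p^(r-1)(t)=μ([0,t]) is taken as a right derivative at every t and a two-sided one where μ({t})=0, with p^(r-2) continuous; read literally the claim fails for r=2, f(x)=e^{-x}/x^2, where p(t)=max(0,t-1). *)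

theory Defs
  imports "HOL-Analysis.Analysis"
begin

text \<open>Only the values of \<open>g\<close> on \<open>(0,\<infinity>)\<close> matter: this set is open, so the iterated
  \<^const>\<open>deriv\<close> at a point \<open>x > 0\<close> depends only on \<open>g\<close> near \<open>x\<close>.\<close>

definition completely_monotonic :: "(real \<Rightarrow> real) \<Rightarrow> bool" where
  "completely_monotonic g \<longleftrightarrow>
     (\<forall>n. \<forall>x>0. (deriv ^^ n) g field_differentiable at x) \<and>
     (\<forall>n. \<forall>x>0. 0 \<le> (- 1) ^ n * (deriv ^^ n) g x)"

definition radon_measure_halfline :: "real measure \<Rightarrow> bool" where
  "radon_measure_halfline M \<longleftrightarrow>
     sets M = sets (restrict_space borel {0..}) \<and>
     (\<forall>K. compact K \<and> K \<subseteq> {0..} \<longrightarrow> emeasure M K < \<infinity>) \<and>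
     (\<forall>B\<in>sets M. emeasure M B = (SUP K\<in>{K. K \<subseteq> B \<and> compact K}. emeasure M K))"

text \<open>The derivative of a function on \<open>[0,\<infinity>)\<close>: two-sided at \<open>t > 0\<close> and one-sided at \<open>0\<close>.
  Values at negative arguments are irrelevant.\<close>

definition halfline_deriv :: "(real \<Rightarrow> real) \<Rightarrow> real \<Rightarrow> real" where
  "halfline_deriv p t = vector_derivative p (at t within {0..})"

definition times_differentiable_halfline :: "nat \<Rightarrow> (real \<Rightarrow> real) \<Rightarrow> bool" where
  "times_differentiable_halfline n p \<longleftrightarrow>
     (\<forall>k<n. (halfline_deriv ^^ k) p differentiable_on {0..})"

text \<open>
  \<open>nth_deriv_is_distribution n p M\<close> says that \<open>p\<^sup>(\<^sup>n\<^sup>)(t) = M([0,t])\<close> on \<open>[0,\<infinity>)\<close>.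
  For \<open>n \<ge> 1\<close> the top derivative cannot be an ordinary derivative at an atom \<open>t > 0\<close> of \<open>M\<close>,
  because derivatives have no jumps: with \<open>r = 2\<close> and \<open>f(x) = e\<^sup>-\<^sup>x / x\<^sup>2\<close> one has
  \<open>p(t) = max 0 (t - 1)\<close> and \<open>M\<close> is the point mass at \<open>1\<close>. As \<open>t \<mapsto> M([0,t])\<close>
  is right-continuous, the top derivative is therefore taken from the right at every \<open>t\<close>,
  and it is required to be an ordinary derivative at every \<open>t\<close> which is not an atom.
  Continuity of \<open>p\<^sup>(\<^sup>n\<^sup>-\<^sup>1\<^sup>)\<close>, implied by ordinary differentiability, is kept explicitly.
  All derivatives of order below \<open>n\<close> are ordinary ones.
\<close>

definition nth_deriv_is_distribution :: "nat \<Rightarrow> (real \<Rightarrow> real) \<Rightarrow> real measure \<Rightarrow> bool" where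
  "nth_deriv_is_distribution n p M \<longleftrightarrow>
     (case n of
        0 \<Rightarrow> \<forall>t\<ge>0. p t = measure M {0..t}
      | Suc m \<Rightarrow>
          times_differentiable_halfline m p \<and>
          continuous_on {0..} ((halfline_deriv ^^ m) p) \<and>
          (\<forall>t\<ge>0. ((halfline_deriv ^^ m) p has_real_derivative measure M {0..t})
                    (at t within {t..})) \<and>
          (\<forall>t\<ge>0. measure M {t} = 0 \<longrightarrow>
             ((halfline_deriv ^^ m) p has_real_derivative measure M {0..t})
                    (at t within {0..})))"

end

theory Submission
  imports Defs "HOL-Probability.Probability"
begin

text \<open>
  By Tonelli, taking the antiderivative that vanishes at \<open>0\<close> divides a Laplace transform by \<open>x\<close>, and the
  conditions on \<open>p\<close> say exactly that \<open>p\<close> is the \<open>(r - 1)\<close>-fold antiderivative of \<open>t \<mapsto> M [0, t]\<close>. Hence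
  \<open>x^r f(x)\<close> is the Laplace transform of \<open>M\<close>, and the claim reduces to the Bernstein--Widder theorem.
  For that theorem, Taylor expansion about \<open>1 + b\<close> exhibits \<open>g\<close> approximately as the transform of a discrete
  measure of mass \<open>g(1)\<close> and first moment \<open>- g'(1)\<close>. These measures are tight as \<open>b \<rightarrow> \<infinity>\<close>, and Helly's
  theorem yields the representation on \<open>[1, \<infinity>)\<close>. It extends to \<open>(0, \<infinity>)\<close> because the Taylor
  series of \<open>g\<close> about \<open>2\<close> has nonnegative terms there and converges to \<open>g\<close>.
\<close>

subsection \<open>Taylor series of completely monotonic functions\<close>

text \<open>Differentiating in the centre instead of the argument makes consecutive terms cancel, so
  only the top one survives. This yields both the monotonicity in the centre and the Cauchy
  remainder used below.\<close>

lemma taylor_center_has_derivative: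
  fixes d :: "nat \<Rightarrow> real \<Rightarrow> real"
  assumes "\<And>n. (d n has_real_derivative d (Suc n) c) (at c)"
  shows "((\<lambda>c. \<Sum>k<Suc n. d k c * (x - c) ^ k / fact k)
           has_real_derivative d (Suc n) c * (x - c) ^ n / fact n) (at c)"
proof (induction n)
  case 0
  show ?case using assms[of 0] by simp
next
  case (Suc n)
  have "((\<lambda>c. d (Suc n) c * (x - c) ^ Suc n / fact (Suc n)) has_real_derivative
      (d (Suc (Suc n)) c * (x - c) ^ Suc n - d (Suc n) c * (real (Suc n) * (x - c) ^ n)) / fact (Suc n)) (at c)"
    by (rule derivative_eq_intros assms refl | simp)+
  from DERIV_add[OF Suc.IH this]
  show ?case
    by (simp add: field_simps del: power_Suc of_nat_Suc)
qed

text \<open>The remainder in Cauchy's form is dominated by a geometric factor: all terms of the expansion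
  about \<open>\<xi>\<close> evaluated at \<open>x / 2\<close> are nonnegative, which bounds \<open>d n \<xi>\<close> by \<open>d 0 (x / 2)\<close>.\<close>

lemma alternating_derivatives_taylor_sums:
  fixes d :: "nat \<Rightarrow> real \<Rightarrow> real"
  assumes deriv: "\<And>n x. x > 0 \<Longrightarrow> (d n has_real_derivative d (Suc n) x) (at x)"
    and sign: "\<And>n x. x > 0 \<Longrightarrow> 0 \<le> (- 1) ^ n * d n x"
    and x: "0 < x" "x \<le> a"
  shows "(\<lambda>k. (- 1) ^ k * d k a * (a - x) ^ k / fact k) sums d 0 x"
proof (cases "x = a")
  case True
  have "(\<lambda>k. (- 1) ^ k * d k a * (a - x) ^ k / fact k) = (\<lambda>k. if k = 0 then d 0 x else 0)"
    using True by (auto simp: fun_eq_iff)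
  then show ?thesis using sums_single[of 0 "\<lambda>_. d 0 x"] by (simp add: eq_commute)
next
  case False
  define T where "T n z c = (\<Sum>k<Suc n. d k c * (z - c) ^ k / fact k)" for n z c
  have T_deriv: "(T n z has_real_derivative d (Suc n) c * (z - c) ^ n / fact n) (at c)" if "c > 0" for n z c
    unfolding T_def using taylor_center_has_derivative[where d=d and c=c and n=n and x=z] deriv[OF that] by blast
  have T_self: "T n z z = d 0 z" for n z
    unfolding T_def by (subst sum.lessThan_Suc_shift) simp
  have flip: "u * (z - c) ^ n = (- 1) ^ n * u * (c - z) ^ n" for u z c :: real and n
    using power_mult_distrib[of "-1" "c - z" n] by simp
  have term_nonneg: "0 \<le> d n c * (z - c) ^ n / fact n" if "0 < z" "z \<le> c" for n z c
    unfolding flip[of _ z c] using sign[of c n] that by simp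
  have bound: "(- 1) ^ n * d n \<xi> * (\<xi> - y) ^ n / fact n \<le> d 0 y" if "0 < y" "y \<le> \<xi>" for n y \<xi>
  proof -
    have "(- 1) ^ n * d n \<xi> * (\<xi> - y) ^ n / fact n \<le> T n y \<xi>"
      unfolding T_def flip[of _ y \<xi>, symmetric] using term_nonneg[OF that]
      by (intro member_le_sum) auto
    \<comment> \<open>Moving the centre from \<xi> down to \<open>y\<close> can only raise the
      polynomial, since its derivative in the centre is nonpositive there; at centre
      \<open>y\<close> only the constant term is left.\<close>
    also have "\<dots> \<le> T n y y"
    proof (rule DERIV_nonpos_imp_nonincreasing[OF that(2)])
      fix c assume c: "y \<le> c" "c \<le> \<xi>"
      have "d (Suc n) c * (y - c) ^ n = - ((- 1) ^ Suc n * d (Suc n) c * (c - y) ^ n)"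
        unfolding flip[of _ y c] by simp
      also have "\<dots> \<le> 0"
        using mult_nonneg_nonneg[OF sign[of c "Suc n"], of "(c - y) ^ n"] c that by simp
      finally have "d (Suc n) c * (y - c) ^ n / fact n \<le> 0"
        by (simp add: divide_le_0_iff)
      then show "\<exists>D. (T n y has_real_derivative D) (at c) \<and> D \<le> 0"
        using T_deriv[of c n y] c that by fastforce
    qed
    finally show ?thesis by (simp add: T_self)
  qed
  \<comment> \<open>An auxiliary point strictly between 0 and \<open>x\<close>. Applying
    \<open>bound\<close> at \<open>y\<close> controls the derivative at \<xi>, and the ratio of
    \<xi> - x to \<xi> - y increases with \<xi>, so its value \<open>q\<close> at \<open>a\<close>
    bounds it uniformly and is below 1.\<close>
  define y where "y = x / 2"
  define q where "q = (a - x) / (a - y)"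
  define B where "B = (a - x) / (x - y) * d 0 y"
  have xa: "x < a" and y: "0 < y" "y < x" using x False by (auto simp: y_def)
  have q: "0 < q" "q < 1" unfolding q_def using xa y by auto
  have rem: "norm (d 0 x - T n x a) \<le> B * (real (Suc n) * q ^ n)" for n
  proof -
    obtain \<xi> where \<xi>: "x < \<xi>" "\<xi> < a" "T n x a - T n x x = (a - x) * (d (Suc n) \<xi> * (x - \<xi>) ^ n / fact n)"
      using MVT2[OF xa, of "T n x" "\<lambda>c. d (Suc n) c * (x - c) ^ n / fact n"] T_deriv x by auto
    define D where "D = (- 1) ^ Suc n * d (Suc n) \<xi>"
    have D: "0 \<le> D" unfolding D_def using sign[of \<xi> "Suc n"] \<xi> x by simp
    have eq: "d 0 x - T n x a = (a - x) * (D * (\<xi> - x) ^ n / fact n)"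
      using \<xi>(3) unfolding T_self flip[of _ x \<xi>] D_def by (simp add: field_simps)
    have "D * (\<xi> - y) ^ Suc n / fact (Suc n) \<le> d 0 y"
      unfolding D_def using bound[of y \<xi> "Suc n"] y \<xi> by simp
    then have D_le: "D / fact n \<le> real (Suc n) * d 0 y / (\<xi> - y) ^ Suc n"
      using y \<xi> by (simp add: field_simps del: power_Suc of_nat_Suc)
    have dy: "0 \<le> d 0 y" using sign[of y 0] y by simp
    have q': "(\<xi> - x) / (\<xi> - y) \<le> q"
    proof -
      have "(\<xi> - x) * (a - y) \<le> (a - x) * (\<xi> - y)"
        using mult_nonneg_nonneg[of "a - \<xi>" "x - y"] \<xi> y by (simp add: algebra_simps)
      then show ?thesis unfolding q_def using \<xi> y by (simp add: divide_simps)
    qed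
    have "D * (\<xi> - x) ^ n / fact n \<le> real (Suc n) * d 0 y / (\<xi> - y) ^ Suc n * (\<xi> - x) ^ n"
      using mult_right_mono[OF D_le, of "(\<xi> - x) ^ n"] \<xi> by simp
    also have "\<dots> = real (Suc n) * d 0 y / (\<xi> - y) * ((\<xi> - x) / (\<xi> - y)) ^ n"
      by (simp add: power_divide)
    also have "\<dots> \<le> real (Suc n) * d 0 y / (x - y) * q ^ n"
      using \<xi> y dy q' by (intro mult_mono power_mono frac_le) auto
    finally have "(a - x) * (D * (\<xi> - x) ^ n / fact n) \<le> (a - x) * (real (Suc n) * d 0 y / (x - y) * q ^ n)"
      using xa by (intro mult_left_mono) auto
    moreover have "0 \<le> (a - x) * (D * (\<xi> - x) ^ n / fact n)" using xa \<xi> D by simp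
    ultimately show ?thesis unfolding eq B_def by (simp add: mult_ac)
  qed
  have "(\<lambda>n. real n * q ^ n) \<longlonglongrightarrow> 0" "(\<lambda>n. q ^ n) \<longlonglongrightarrow> 0"
    using powser_times_n_limit_0[of q] q by (auto intro!: LIMSEQ_power_zero)
  from tendsto_add[OF this] have "(\<lambda>n. real (Suc n) * q ^ n) \<longlonglongrightarrow> 0"
    by (simp add: algebra_simps)
  from tendsto_mult_left[OF this, of B] have "(\<lambda>n. B * (real (Suc n) * q ^ n)) \<longlonglongrightarrow> 0" by simp
  have "(\<lambda>n. d 0 x - T n x a) \<longlonglongrightarrow> 0"
    by (rule Lim_null_comparison[OF always_eventually \<open>(\<lambda>n. B * (real (Suc n) * q ^ n)) \<longlonglongrightarrow> 0\<close>])
      (use rem in blast)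
  from tendsto_diff[OF tendsto_const[of "d 0 x"] this] have "(\<lambda>n. T n x a) \<longlonglongrightarrow> d 0 x" by simp
  then have "(\<lambda>n. \<Sum>k<n. d k a * (x - a) ^ k / fact k) \<longlonglongrightarrow> d 0 x"
    unfolding T_def by (rule LIMSEQ_imp_Suc)
  then show ?thesis unfolding sums_def flip[of _ x a] .
qed

lemma completely_monotonic_has_derivative:
  assumes "completely_monotonic g" "x > 0"
  shows "((deriv ^^ n) g has_real_derivative (deriv ^^ Suc n) g x) (at x)"
  using assms unfolding completely_monotonic_def
  by (simp add: field_differentiable_derivI)

lemma completely_monotonic_taylor_sums:
  assumes "completely_monotonic g" "0 < x" "x \<le> a"
  shows "(\<lambda>k. (- 1) ^ k * (deriv ^^ k) g a * (a - x) ^ k / fact k) sums g x"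
  using alternating_derivatives_taylor_sums[of "\<lambda>k. (deriv ^^ k) g" x a]
    completely_monotonic_has_derivative[OF assms(1)] assms
  unfolding completely_monotonic_def by simp

text \<open>The derivatives of -g' alternate in sign as well, so the general expansion applies to
  the shifted family. This series later supplies the first moments that give tightness.\<close>

lemma completely_monotonic_taylor_sums_deriv:
  assumes g: "completely_monotonic g" and x: "0 < x" "x \<le> a"
  shows "(\<lambda>k. (- 1) ^ Suc k * (deriv ^^ Suc k) g a * (a - x) ^ k / fact k) sums (- deriv g x)"
proof -
  define d where "d k x = - (deriv ^^ Suc k) g x" for k x
  have "0 \<le> (- 1) ^ n * d n x" if "x > 0" for n x
  proof -
    have "0 \<le> (- 1) ^ Suc n * (deriv ^^ Suc n) g x"
      using g that unfolding completely_monotonic_def by blast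
    then show ?thesis unfolding d_def by (simp del: funpow.simps)
  qed
  moreover have "(d n has_real_derivative d (Suc n) x) (at x)" if "x > 0" for n x
    unfolding d_def by (rule DERIV_minus[OF completely_monotonic_has_derivative[OF g that]])
  ultimately have "(\<lambda>k. (- 1) ^ k * d k a * (a - x) ^ k / fact k) sums d 0 x"
    using x by (intro alternating_derivatives_taylor_sums)
  then show ?thesis unfolding d_def by (simp del: funpow.simps(2)) simp
qed

subsection \<open>Laplace transforms of measures on the half-line\<close>

text \<open>A single term of the exponential series is at most the sum. A power of \<open>t\<close>
  can thus be absorbed by slightly lowering the decay rate of an exponential.\<close>

lemma power_le_fact_mult_exp:
  fixes t \<delta> :: real
  assumes "0 \<le> t" "0 < \<delta>"
  shows "t ^ n \<le> fact n / \<delta> ^ n * exp (\<delta> * t)"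
proof -
  have "(\<lambda>k. (\<delta> * t) ^ k /\<^sub>R fact k) sums exp (\<delta> * t)"
    by (rule exp_converges)
  then have "(\<Sum>k\<in>{n}. (\<delta> * t) ^ k /\<^sub>R fact k) \<le> exp (\<delta> * t)"
    using assms sum_le_suminf[of "\<lambda>k. (\<delta> * t) ^ k /\<^sub>R fact k" "{n}"] by (auto simp: sums_iff)
  then show ?thesis using assms by (simp add: field_simps power_mult_distrib)
qed

lemma halfline_measurable:
  assumes "sets M = sets (restrict_space borel {0..})" "h \<in> borel_measurable borel"
  shows "h \<in> borel_measurable M"
  using measurable_restrict_space1[OF assms(2), of "{0..}"] measurable_cong_sets[OF assms(1) refl] by blast

lemma halfline_space:
  assumes "sets M = sets (restrict_space borel {0..})"
  shows "space M = {0..}"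
  using sets_eq_imp_space_eq[OF assms] by (simp add: space_restrict_space)

context
  fixes M :: "real measure" and c :: real
  assumes M: "sets M = sets (restrict_space borel {0..})"
    and int: "\<And>x. x > c \<Longrightarrow> integrable M (\<lambda>t. exp (- (x * t)))"
begin

text \<open>With \<open>\<delta>\<close> half the distance from \<open>x\<close> to
  \<open>c\<close>, the rate \<open>x - \<delta>\<close> is still above \<open>c\<close>, which
  leaves an integrable majorant after the power has been absorbed.\<close>

lemma integrable_power_laplace:
  assumes "x > c"
  shows "integrable M (\<lambda>t. (- t) ^ n * exp (- (x * t)))"
proof (rule Bochner_Integration.integrable_bound)
  define \<delta> where "\<delta> = (x - c) / 2"
  show "integrable M (\<lambda>t. fact n / \<delta> ^ n * exp (- ((x - \<delta>) * t)))"
    using assms by (intro integrable_mult_right int) (simp add: \<delta>_def field_simps)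
  show "(\<lambda>t. (- t) ^ n * exp (- (x * t))) \<in> borel_measurable M"
    by (rule halfline_measurable[OF M]) simp
  show "AE t in M. norm ((- t) ^ n * exp (- (x * t))) \<le> norm (fact n / \<delta> ^ n * exp (- ((x - \<delta>) * t)))"
  proof (rule AE_I2)
    fix t assume "t \<in> space M"
    then have t: "0 \<le> t" using halfline_space[OF M] by simp
    have \<delta>: "\<delta> > 0" using assms by (simp add: \<delta>_def)
    have "t ^ n * exp (- (x * t)) \<le> fact n / \<delta> ^ n * exp (\<delta> * t) * exp (- (x * t))"
      by (intro mult_right_mono power_le_fact_mult_exp t \<delta>) auto
    also have "\<dots> = fact n / \<delta> ^ n * exp (- ((x - \<delta>) * t))"
      by (simp add: exp_add[symmetric] algebra_simps)
    finally show "norm ((- t) ^ n * exp (- (x * t))) \<le> norm (fact n / \<delta> ^ n * exp (- ((x - \<delta>) * t)))"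
      using t \<delta> by (simp add: abs_mult power_abs)
  qed
qed

lemma has_derivative_power_laplace:
  assumes x: "x > c"
  shows "((\<lambda>x. \<integral>t. (- t) ^ n * exp (- (x * t)) \<partial>M) has_real_derivative
           (\<integral>t. (- t) ^ Suc n * exp (- (x * t)) \<partial>M)) (at x)"
  unfolding has_field_derivative_iff tendsto_at_iff_sequentially
proof (intro allI impI)
  fix X :: "nat \<Rightarrow> real" assume "\<forall>i. X i \<in> UNIV - {x}" and X: "X \<longlonglongrightarrow> x"
  then have neq: "X i \<noteq> x" for i by auto
  \<comment> \<open>Eventually all \<open>X i\<close> lie above this midpoint. There the derivative
    of the kernel in \<open>u\<close> is at most \<open>t * exp (- (y * t))\<close> in absolute
    value, so the mean value inequality gives one integrable majorant for all difference
    quotients.\<close>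
  define y where "y = (x + c) / 2"
  have y: "c < y" "y < x" using x by (auto simp: y_def field_simps)
  from order_tendstoD(1)[OF X y(2)] obtain N where N: "\<And>i. i \<ge> N \<Longrightarrow> y < X i"
    by (auto simp: eventually_sequentially)
  define q where "q i t = (- t) ^ n * ((exp (- (X i * t)) - exp (- (x * t))) / (X i - x))" for i t
  have der: "((\<lambda>u. exp (- (u * t))) has_real_derivative - t * exp (- (u * t))) (at u)" for u t :: real
    by (auto intro!: derivative_eq_intros)
  have lim: "(\<lambda>i. q i t) \<longlonglongrightarrow> (- t) ^ Suc n * exp (- (x * t))" for t
  proof -
    have "(\<lambda>i. (exp (- (X i * t)) - exp (- (x * t))) / (X i - x)) \<longlonglongrightarrow> - t * exp (- (x * t))"
      using der[of t x] X neq unfolding has_field_derivative_iff tendsto_at_iff_sequentially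
      by (auto simp: comp_def)
    from tendsto_mult_left[OF this, of "(- t) ^ n"] show ?thesis
      unfolding q_def by (simp add: mult_ac)
  qed
  have bound: "norm (q (i + N) t) \<le> norm ((- t) ^ Suc n * exp (- (y * t)))" if t: "0 \<le> t" for i t
  proof -
    let ?X = "X (i + N)"
    have yX: "y < ?X" using N by simp
    have "norm (exp (- (?X * t)) - exp (- (x * t))) \<le> (t * exp (- (y * t))) * norm (?X - x)"
    proof (rule field_differentiable_bound[where S = "{y<..}" and f' = "\<lambda>u. - t * exp (- (u * t))"])
      show "((\<lambda>u. exp (- (u * t))) has_field_derivative - t * exp (- (z * t))) (at z within {y<..})" for z
        using der by (rule DERIV_subset) simp
      show "norm (- t * exp (- (z * t))) \<le> t * exp (- (y * t))" if "z \<in> {y<..}" for z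
        using that t by (auto simp: abs_mult intro!: mult_left_mono mult_right_mono)
    qed (use y yX in auto)
    then have "norm ((exp (- (?X * t)) - exp (- (x * t))) / (?X - x)) \<le> t * exp (- (y * t))"
      using neq[of "i + N"] by (simp add: field_simps)
    from mult_left_mono[OF this, of "t ^ n"] t show ?thesis
      unfolding q_def by (simp add: abs_mult power_abs mult_ac)
  qed
  have "(\<lambda>i. \<integral>t. q (i + N) t \<partial>M) \<longlonglongrightarrow> (\<integral>t. (- t) ^ Suc n * exp (- (x * t)) \<partial>M)"
  proof (rule integral_dominated_convergence)
    show "(\<lambda>t. (- t) ^ Suc n * exp (- (x * t))) \<in> borel_measurable M"
      by (rule halfline_measurable[OF M]) simp
    show "q (i + N) \<in> borel_measurable M" for i
      unfolding q_def by (rule halfline_measurable[OF M]) simp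
    show "integrable M (\<lambda>t. norm ((- t) ^ Suc n * exp (- (y * t))))"
      by (intro integrable_norm integrable_power_laplace y)
    show "AE t in M. norm (q (i + N) t) \<le> norm ((- t) ^ Suc n * exp (- (y * t)))" for i
      using bound halfline_space[OF M] by (intro AE_I2) auto
    show "AE t in M. (\<lambda>i. q (i + N) t) \<longlonglongrightarrow> (- t) ^ Suc n * exp (- (x * t))"
      using LIMSEQ_ignore_initial_segment[OF lim] by (intro AE_I2)
  qed
  moreover have "(\<integral>t. q (i + N) t \<partial>M) =
      ((\<integral>t. (- t) ^ n * exp (- (X (i + N) * t)) \<partial>M) - (\<integral>t. (- t) ^ n * exp (- (x * t)) \<partial>M)) / (X (i + N) - x)" for i
    using integrable_power_laplace[of "X (i + N)" n] integrable_power_laplace[OF x, of n] N[of "i + N"] y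
    unfolding q_def by (simp add: right_diff_distrib diff_divide_distrib)
  ultimately have "(\<lambda>i. ((\<lambda>y. ((\<integral>t. (- t) ^ n * exp (- (y * t)) \<partial>M) - (\<integral>t. (- t) ^ n * exp (- (x * t)) \<partial>M)) / (y - x)) \<circ> X) (i + N))
      \<longlonglongrightarrow> (\<integral>t. (- t) ^ Suc n * exp (- (x * t)) \<partial>M)"
    by (simp only: comp_def)
  then show "((\<lambda>y. ((\<integral>t. (- t) ^ n * exp (- (y * t)) \<partial>M) - (\<integral>t. (- t) ^ n * exp (- (x * t)) \<partial>M)) / (y - x)) \<circ> X)
      \<longlonglongrightarrow> (\<integral>t. (- t) ^ Suc n * exp (- (x * t)) \<partial>M)"
    by (rule LIMSEQ_offset)
qed

text \<open>The bound \<open>c\<close> will be 0 for transforms known on the whole of (0,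
  \<infinity>) and 1 in \<open>laplace_extend\<close>, where the transform is known only beyond 1.
  Value and derivative go through the induction together, because the next value is the present
  derivative.\<close>

lemma iterated_deriv_laplace:
  assumes g: "\<And>x. x > c \<Longrightarrow> g x = (\<integral>t. exp (- (x * t)) \<partial>M)" and "x > c"
  shows "((deriv ^^ n) g has_real_derivative (\<integral>t. (- t) ^ Suc n * exp (- (x * t)) \<partial>M)) (at x)
    \<and> (deriv ^^ n) g x = (\<integral>t. (- t) ^ n * exp (- (x * t)) \<partial>M)"
  using \<open>x > c\<close>
proof (induction n arbitrary: x)
  case 0
  have "(g has_real_derivative (\<integral>t. (- t) ^ Suc 0 * exp (- (x * t)) \<partial>M)) (at x)"
    by (rule has_field_derivative_transform_within_open[OF has_derivative_power_laplace[OF 0, of 0], of "{c<..}"])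
      (use g 0 in auto)
  then show ?case using g 0 by simp
next
  case (Suc n)
  have eq: "(deriv ^^ Suc n) g y = (\<integral>t. (- t) ^ Suc n * exp (- (y * t)) \<partial>M)" if "y > c" for y
    using Suc.IH[OF that] by (auto intro: DERIV_imp_deriv)
  have "((deriv ^^ Suc n) g has_real_derivative (\<integral>t. (- t) ^ Suc (Suc n) * exp (- (x * t)) \<partial>M)) (at x)"
    by (rule has_field_derivative_transform_within_open[OF has_derivative_power_laplace[OF Suc.prems, of "Suc n"], of "{c<..}"])
      (use eq Suc.prems in auto)
  then show ?case using eq[OF Suc.prems] by blast
qed

end

lemma laplace_integral_of_nn_integral:
  assumes M: "sets M = sets (restrict_space borel {0..})"
    and g: "(\<integral>\<^sup>+t. ennreal (exp (- (x * t))) \<partial>M) = ennreal a" "0 \<le> a"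
  shows "integrable M (\<lambda>t. exp (- (x * t)))" "(\<integral>t. exp (- (x * t)) \<partial>M) = a"
proof -
  have [measurable]: "(\<lambda>t. exp (- (x * t))) \<in> borel_measurable M"
    by (rule halfline_measurable[OF M]) simp
  have "has_bochner_integral M (\<lambda>t. exp (- (x * t))) a"
    using g by (intro has_bochner_integral_nn_integral) auto
  then show "integrable M (\<lambda>t. exp (- (x * t)))" "(\<integral>t. exp (- (x * t)) \<partial>M) = a"
    by (auto simp: has_bochner_integral_iff)
qed

text \<open>The easy half of the Bernstein--Widder theorem: differentiating under the integral
  produces \<open>(- t) ^ n\<close>, whose sign on the half-line cancels
  \<open>(- 1) ^ n\<close>.\<close>

lemma completely_monotonic_laplace:
  assumes M: "sets M = sets (restrict_space borel {0..})"
    and g: "\<And>x. x > 0 \<Longrightarrow> (\<integral>\<^sup>+t. ennreal (exp (- (x * t))) \<partial>M) = ennreal (g x)"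
      "\<And>x. x > 0 \<Longrightarrow> 0 \<le> g x"
  shows "completely_monotonic g"
proof -
  note L = laplace_integral_of_nn_integral[OF M g]
  have D: "((deriv ^^ n) g has_real_derivative (\<integral>t. (- t) ^ Suc n * exp (- (x * t)) \<partial>M)) (at x)"
     "(deriv ^^ n) g x = (\<integral>t. (- t) ^ n * exp (- (x * t)) \<partial>M)" if "x > 0" for n x
    using iterated_deriv_laplace[OF M L(1), of 0 g x n] L(2) that by auto
  have "0 \<le> (- 1) ^ n * (deriv ^^ n) g x" if "x > 0" for n x
  proof -
    have "(- 1) ^ n * (deriv ^^ n) g x = (\<integral>t. t ^ n * exp (- (x * t)) \<partial>M)"
      unfolding D(2)[OF that] by (simp flip: integral_mult_right_zero mult.assoc power_mult_distrib)
    also have "\<dots> \<ge> 0"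
      using halfline_space[OF M] by (intro integral_nonneg_AE AE_I2) auto
    finally show ?thesis .
  qed
  then show ?thesis
    using D(1) unfolding completely_monotonic_def field_differentiable_def by blast
qed

subsection \<open>Iterated antiderivatives\<close>

lemma nn_integral_exp_atLeast:
  assumes "x > 0"
  shows "(\<integral>\<^sup>+t. ennreal (exp (- (x * t))) * indicator {s..} t \<partial>lborel) = ennreal (1 / x) * ennreal (exp (- (x * s)))"
proof -
  have "(\<integral>\<^sup>+t. ennreal (exp (- (x * t))) * indicator {s..} t \<partial>lborel) = ennreal (0 - (- exp (- (x * s)) / x))"
  proof (rule nn_integral_FTC_atLeast)
    have "((\<lambda>t. - exp (- (x * t)) / x) \<longlongrightarrow> - 0 / x) at_top"
      using assms by (intro tendsto_intros filterlim_compose[OF exp_at_bot]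
          filterlim_compose[OF filterlim_uminus_at_bot_at_top]
          filterlim_tendsto_pos_mult_at_top[OF tendsto_const _ filterlim_ident]) auto
    then show "((\<lambda>t. - exp (- (x * t)) / x) \<longlongrightarrow> 0) at_top" by simp
  qed (use assms in \<open>auto intro!: derivative_eq_intros\<close>)
  then show ?thesis using assms by (simp flip: ennreal_mult)
qed

text \<open>Tonelli on the region s \<le> t; the inner integral over \<open>t\<close> contributes
  the factor 1/x. The general measure \<open>N\<close> with weight \<open>w\<close> covers both
  Lebesgue antiderivatives and the passage from a measure to its distribution function.\<close>

lemma laplace_of_antiderivative:
  fixes N :: "real measure"
  assumes N: "sigma_finite_measure N" "(\<lambda>t. t) \<in> borel_measurable N"
    and w[measurable]: "w \<in> borel_measurable N" and x: "x > 0"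
  shows "(\<integral>\<^sup>+t. (\<integral>\<^sup>+s. w s * indicator {..t} s \<partial>N) * ennreal (exp (- (x * t))) \<partial>lborel)
    = ennreal (1 / x) * (\<integral>\<^sup>+s. w s * ennreal (exp (- (x * s))) \<partial>N)"
proof -
  interpret N: sigma_finite_measure N by fact
  interpret pair_sigma_finite N lborel ..
  note N(2)[measurable]
  have [measurable]: "(\<lambda>p. indicator {..snd p} (fst p) :: ennreal) \<in> borel_measurable (N \<Otimes>\<^sub>M lborel)"
  proof -
    have eq: "(\<lambda>p. indicator {..snd p} (fst p) :: ennreal) = (\<lambda>p. if fst p \<le> snd p then 1 else 0)"
      by (auto simp: fun_eq_iff)
    show ?thesis unfolding eq by measurable
  qed
  have "(\<integral>\<^sup>+t. (\<integral>\<^sup>+s. w s * indicator {..t} s \<partial>N) * ennreal (exp (- (x * t))) \<partial>lborel)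
      = (\<integral>\<^sup>+t. (\<integral>\<^sup>+s. w s * indicator {..t} s * ennreal (exp (- (x * t))) \<partial>N) \<partial>lborel)"
  proof (rule nn_integral_cong)
    fix t
    have "(\<lambda>s. w s * indicator {..t} s) \<in> borel_measurable N" by measurable
    then show "(\<integral>\<^sup>+s. w s * indicator {..t} s \<partial>N) * ennreal (exp (- (x * t)))
        = (\<integral>\<^sup>+s. w s * indicator {..t} s * ennreal (exp (- (x * t))) \<partial>N)"
      by (rule nn_integral_multc[symmetric])
  qed
  also have "\<dots> = (\<integral>\<^sup>+s. (\<integral>\<^sup>+t. w s * indicator {..t} s * ennreal (exp (- (x * t))) \<partial>lborel) \<partial>N)"
    by (rule Fubini') (simp add: split_beta')
  also have "\<dots> = (\<integral>\<^sup>+s. ennreal (1 / x) * (w s * ennreal (exp (- (x * s)))) \<partial>N)"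
  proof (rule nn_integral_cong)
    fix s
    have "(\<integral>\<^sup>+t. w s * indicator {..t} s * ennreal (exp (- (x * t))) \<partial>lborel)
        = (\<integral>\<^sup>+t. w s * (ennreal (exp (- (x * t))) * indicator {s..} t) \<partial>lborel)"
      by (intro nn_integral_cong) (auto split: split_indicator simp: mult_ac)
    also have "\<dots> = w s * (\<integral>\<^sup>+t. ennreal (exp (- (x * t))) * indicator {s..} t \<partial>lborel)"
      by (rule nn_integral_cmult) simp
    finally show "(\<integral>\<^sup>+t. w s * indicator {..t} s * ennreal (exp (- (x * t))) \<partial>lborel)
        = ennreal (1 / x) * (w s * ennreal (exp (- (x * s))))"
      unfolding nn_integral_exp_atLeast[OF x] by (simp add: mult_ac)
  qed
  also have "\<dots> = ennreal (1 / x) * (\<integral>\<^sup>+s. w s * ennreal (exp (- (x * s))) \<partial>N)"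
    by (rule nn_integral_cmult) simp
  finally show ?thesis .
qed

primrec iterated_integral :: "(real \<Rightarrow> real) \<Rightarrow> nat \<Rightarrow> real \<Rightarrow> real" where
  "iterated_integral F 0 = F"
| "iterated_integral F (Suc j) = (\<lambda>t. integral {0..t} (iterated_integral F j))"

lemma has_real_derivative_cong_on:
  fixes f :: "real \<Rightarrow> real"
  assumes "(f has_real_derivative D) (at t within S)" "t \<in> S" "\<And>u. u \<in> S \<Longrightarrow> g u = f u"
  shows "(g has_real_derivative D) (at t within S)"
  using assms unfolding has_field_derivative_def by (intro has_derivative_transform[of t S g f]) auto

text \<open>Transfers facts about integrals over compact intervals to limits within a
  half-line.\<close>

lemma at_within_Ici_cut: "(t :: real) \<ge> a \<Longrightarrow> at t within {a..t + 1} = at t within {a..}"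
  by (rule at_within_nhd[of t "{..<t + 1}"]) auto

context
  fixes F :: "real \<Rightarrow> real"
  assumes F_mono: "mono F" and F_neg: "\<And>t. t < 0 \<Longrightarrow> F t = 0"
begin

text \<open>The two claims support each other: monotone and zero on the negatives gives nonnegative,
  which makes the next antiderivative monotone. That one vanishes at negative \<open>t\<close>
  because \<open>{0..t}\<close> is empty.\<close>

lemma iterated_integral_mono_neg:
  "mono (iterated_integral F j) \<and> (\<forall>t<0. iterated_integral F j t = 0)"
proof (induction j)
  case 0
  show ?case using F_mono F_neg by simp
next
  case (Suc j)
  let ?I = "iterated_integral F j"
  have nonneg: "0 \<le> ?I t" for t
    using Suc.IH monoD[of ?I "min t (- 1)" t] by (auto simp: min_def split: if_splits)
  have int: "?I integrable_on {a..b}" for a b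
    using Suc.IH by (intro integrable_on_mono_on) (auto simp: mono_def mono_on_def)
  have "integral {0..s} ?I \<le> integral {0..t} ?I" if "s \<le> t" for s t
    using that nonneg by (intro integral_subset_le int) auto
  then show ?case by (auto simp: mono_def)
qed

lemma iterated_integral_mono: "mono (iterated_integral F j)"
  and iterated_integral_neg: "t < 0 \<Longrightarrow> iterated_integral F j t = 0"
  using iterated_integral_mono_neg by auto

lemma iterated_integral_nonneg: "0 \<le> iterated_integral F j t"
  using iterated_integral_neg[of "min t (- 1)" j] monoD[OF iterated_integral_mono[of j], of "min t (- 1)" t] by auto

lemma iterated_integral_measurable [measurable]: "iterated_integral F j \<in> borel_measurable borel"
  by (rule borel_measurable_mono[OF iterated_integral_mono])

lemma iterated_integral_integrable: "iterated_integral F j integrable_on {a..b}"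
  using iterated_integral_mono[of j] by (intro integrable_on_mono_on) (auto simp: mono_def mono_on_def)

lemma iterated_integral_Suc_nn_integral:
  "ennreal (iterated_integral F (Suc j) t) = (\<integral>\<^sup>+s. ennreal (iterated_integral F j s) * indicator {..t} s \<partial>lborel)"
proof -
  have "(iterated_integral F j has_integral iterated_integral F (Suc j) t) {0..t}"
    using iterated_integral_integrable[of j 0 t] by (auto simp: has_integral_integral)
  then have "(\<integral>\<^sup>+s. ennreal (iterated_integral F j s) * indicator {0..t} s \<partial>lborel)
      = ennreal (iterated_integral F (Suc j) t)"
    by (intro nn_integral_has_integral_lebesgue' iterated_integral_nonneg)
  moreover have "(\<integral>\<^sup>+s. ennreal (iterated_integral F j s) * indicator {0..t} s \<partial>lborel)
      = (\<integral>\<^sup>+s. ennreal (iterated_integral F j s) * indicator {..t} s \<partial>lborel)"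
    using iterated_integral_neg by (intro nn_integral_cong) (auto split: split_indicator)
  ultimately show ?thesis by simp
qed

lemma laplace_iterated_integral:
  assumes "x > 0"
  shows "(\<integral>\<^sup>+t. ennreal (iterated_integral F n t) * ennreal (exp (- (x * t))) \<partial>lborel)
    = ennreal ((1 / x) ^ n) * (\<integral>\<^sup>+t. ennreal (F t) * ennreal (exp (- (x * t))) \<partial>lborel)"
proof (induction n)
  case (Suc n)
  have "(\<integral>\<^sup>+t. ennreal (iterated_integral F (Suc n) t) * ennreal (exp (- (x * t))) \<partial>lborel)
     = ennreal (1 / x) * (\<integral>\<^sup>+t. ennreal (iterated_integral F n t) * ennreal (exp (- (x * t))) \<partial>lborel)"
    unfolding iterated_integral_Suc_nn_integral
    by (rule laplace_of_antiderivative[OF lborel.sigma_finite_measure_axioms _ _ assms]) auto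
  then show ?case
    using assms unfolding Suc.IH by (simp add: mult.assoc[symmetric] ennreal_mult[symmetric] mult.commute)
qed simp

lemma iterated_integral_Suc_continuous: "continuous_on {0..} (iterated_integral F (Suc j))"
  unfolding continuous_on_eq_continuous_within
proof
  fix t :: real assume t: "t \<in> {0..}"
  have "continuous_on {0..t + 1} (iterated_integral F (Suc j))"
    using indefinite_integral_continuous_1[OF iterated_integral_integrable[of j 0 "t + 1"]] by simp
  then have "continuous (at t within {0..t + 1}) (iterated_integral F (Suc j))"
    using t by (auto simp: continuous_on_eq_continuous_within)
  then show "continuous (at t within {0..}) (iterated_integral F (Suc j))"
    using t by (simp add: at_within_Ici_cut)
qed

lemma iterated_integral_has_derivative:
  assumes "0 \<le> t" "continuous (at t within {0..}) (iterated_integral F j)"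
  shows "(iterated_integral F (Suc j) has_real_derivative iterated_integral F j t) (at t within {0..})"
  using integral_has_vector_derivative_continuous_at[OF iterated_integral_integrable[of j 0 "t + 1"], of t "{}"] assms
  by (simp add: at_within_Ici_cut has_real_derivative_iff_has_vector_derivative)

text \<open>Splitting the integral at \<open>t\<close> leaves only values of \<open>F\<close> to the
  right of \<open>t\<close>, so the argument works even where \<open>F\<close> jumps.\<close>

lemma integral_has_right_derivative:
  assumes "0 \<le> t" "continuous (at_right t) F"
  shows "(iterated_integral F 1 has_real_derivative F t) (at t within {t..})"
proof -
  have "continuous (at t within {t..}) F"
    using assms(2) by (simp add: continuous_within at_within_Ici_at_right)
  then have "((\<lambda>u. integral {t..u} F) has_real_derivative F t) (at t within {t..})"
    using integral_has_vector_derivative_continuous_at[OF iterated_integral_integrable[of 0 t "t + 1"], of t "{}"]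
    by (simp add: at_within_Ici_cut has_real_derivative_iff_has_vector_derivative)
  then have der: "((\<lambda>u. integral {0..t} F + integral {t..u} F) has_real_derivative F t) (at t within {t..})"
    using DERIV_add[OF DERIV_const] by fastforce
  have eq: "iterated_integral F 1 u = integral {0..t} F + integral {t..u} F" if "u \<in> {t..}" for u
    using Henstock_Kurzweil_Integration.integral_combine[OF assms(1) _ iterated_integral_integrable[of 0 0 u]] that by simp
  show ?thesis
    by (rule has_real_derivative_cong_on[OF der _ eq]) auto
qed

end

section \<open>Functions with zero right derivative\<close>

text \<open>This leads to uniqueness of antiderivatives whose derivative is known only from the
  right, as at atoms. Allow a slope \<open>\<epsilon>\<close> and take the last point
  \<open>c\<close> where \<open>E\<close> is nonpositive: if \<open>c < b\<close>, then
  \<open>E\<close> drops just after \<open>c\<close>, against maximality.\<close>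

lemma zero_right_derivative_imp_le:
  fixes f :: "real \<Rightarrow> real"
  assumes "a \<le> b" "continuous_on {a..b} f"
    and deriv: "\<And>t. a \<le> t \<Longrightarrow> t < b \<Longrightarrow> (f has_real_derivative 0) (at t within {t..})"
  shows "f b \<le> f a"
proof (rule field_le_epsilon)
  fix e :: real assume "e > 0"
  \<comment> \<open>The summand 1 keeps the denominator positive when \<open>a = b\<close>, at the
    price of only an inequality between \<open>\<epsilon> * (b - a)\<close> and
    \<open>e\<close>.\<close>
  define \<epsilon> where "\<epsilon> = e / (b - a + 1)"
  have \<epsilon>: "\<epsilon> > 0" using \<open>e > 0\<close> assms(1) by (simp add: \<epsilon>_def)
  define E where "E s = f s - f a - \<epsilon> * (s - a)" for s
  define S where "S = {s \<in> {a..b}. E s \<le> 0}"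
  have cE: "continuous_on {a..b} E"
    unfolding E_def using assms(2) by (intro continuous_intros)
  have "compact S"
    unfolding S_def using continuous_closed_preimage[OF cE, of "{..0}"]
    by (auto simp: compact_eq_bounded_closed vimage_def Int_def intro: bounded_subset[OF bounded_closed_interval[of a b]])
  moreover have "a \<in> S" using assms(1) by (simp add: S_def E_def)
  ultimately obtain c where c: "c \<in> S" "\<And>s. s \<in> S \<Longrightarrow> s \<le> c"
    using compact_attains_sup[of S] by auto
  have "c = b"
  proof (rule ccontr)
    assume "c \<noteq> b"
    then have cb: "a \<le> c" "c < b" using c(1) by (auto simp: S_def)
    have "(E has_real_derivative - \<epsilon>) (at c within {c..})"
      unfolding E_def using deriv[OF cb] by (auto intro!: derivative_eq_intros)
    then obtain d where d: "d > 0" "\<And>h. h > 0 \<Longrightarrow> c + h \<in> {c..} \<Longrightarrow> h < d \<Longrightarrow> E (c + h) < E c"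
      using has_real_derivative_neg_dec_right[of E "- \<epsilon>" c "{c..}"] \<epsilon> by auto
    define h where "h = min (d / 2) (b - c)"
    have "E (c + h) < E c" using d cb by (auto simp: h_def min_def)
    then have "c + h \<in> S" using c(1) cb d(1) by (auto simp: S_def h_def min_def)
    then show False using c(2)[of "c + h"] d(1) cb by (auto simp: h_def min_def split: if_splits)
  qed
  then have "f b \<le> f a + \<epsilon> * (b - a)" using c(1) by (auto simp: S_def E_def)
  also have "\<epsilon> * (b - a) \<le> e" using assms(1) \<open>e > 0\<close> by (simp add: \<epsilon>_def field_simps)
  finally show "f b \<le> f a + e" by simp
qed

lemma zero_right_derivative_imp_eq:
  fixes f :: "real \<Rightarrow> real"
  assumes "a \<le> b" "continuous_on {a..b} f"
    and deriv: "\<And>t. a \<le> t \<Longrightarrow> t < b \<Longrightarrow> (f has_real_derivative 0) (at t within {t..})"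
  shows "f b = f a"
proof (rule antisym)
  show "f b \<le> f a" using assms by (rule zero_right_derivative_imp_le)
  have "((\<lambda>t. - f t) has_real_derivative 0) (at t within {t..})" if "a \<le> t" "t < b" for t
    using DERIV_minus[OF deriv[OF that]] by simp
  with assms(1) continuous_on_minus[OF assms(2)] have "- f b \<le> - f a"
    by (rule zero_right_derivative_imp_le)
  then show "f a \<le> f b" by simp
qed

lemma at_within_Ici_neq_bot: "(t :: real) \<ge> a \<Longrightarrow> at t within {a..} \<noteq> bot"
proof
  assume a: "t \<ge> a" and bot: "at t within {a..} = bot"
  have "{t<..} \<subseteq> {a..}" using a by (intro subsetI) simp
  from at_le[OF this, of t] have "at_right t = bot" unfolding bot by (rule le_bot)
  then show False by simp
qed

lemma halfline_deriv_eq: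
  assumes "0 \<le> t" "(p has_real_derivative D) (at t within {0..})"
  shows "halfline_deriv p t = D"
  unfolding halfline_deriv_def
  using assms by (intro vector_derivative_within at_within_Ici_neq_bot)
    (auto simp: has_real_derivative_iff_has_vector_derivative)

lemma halfline_deriv_works:
  assumes "0 \<le> t" "p differentiable_on {0..}"
  shows "(p has_real_derivative halfline_deriv p t) (at t within {0..})"
  using assms unfolding halfline_deriv_def has_real_derivative_iff_has_vector_derivative
  by (auto simp: differentiable_on_def vector_derivative_works)

section \<open>Distribution functions of measures on the half-line\<close>

locale halfline_measure =
  fixes M :: "real measure"
  assumes sets_M: "sets M = sets (restrict_space borel {0..})"
    and finite_Icc: "emeasure M {0..b} < \<infinity>"
begin

lemma emeasure_Icc_neq_top: "emeasure M {0..b} \<noteq> top"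
  using finite_Icc[of b] by simp

lemma in_sets_M: "A \<in> sets M \<longleftrightarrow> A \<subseteq> {0..} \<and> A \<in> sets borel"
  unfolding sets_M by (subst sets_restrict_space_iff) auto

definition "distribution t = measure M {0..t}"

lemma distribution_mono: "mono distribution"
proof (rule monoI)
  fix s t :: real assume "s \<le> t"
  then show "distribution s \<le> distribution t"
    unfolding distribution_def using finite_Icc[of t]
    by (intro measure_mono_fmeasurable) (auto simp: in_sets_M fmeasurable_def)
qed

lemma distribution_neg: "t < 0 \<Longrightarrow> distribution t = 0"
  by (simp add: distribution_def)

lemma sigma_finite: "sigma_finite_measure M"
proof
  have "{0..} = (\<Union>n. {0..real n})"
    using real_arch_simple by auto
  then show "\<exists>A. countable A \<and> A \<subseteq> sets M \<and> \<Union> A = space M \<and> (\<forall>a\<in>A. emeasure M a \<noteq> \<infinity>)"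
    using emeasure_Icc_neq_top by (intro exI[of _ "range (\<lambda>n. {0..real n})"])
      (auto simp: in_sets_M halfline_space[OF sets_M])
qed

text \<open>The part of \<open>M\<close> on [0, b] seen as a finite Borel measure on the whole line,
  so that the theory of cumulative distribution functions and inner regularity applies.\<close>

definition "trunc b = distr (restrict_space M {0..b}) borel (\<lambda>t. t)"

lemma emeasure_trunc:
  assumes "A \<in> sets borel"
  shows "emeasure (trunc b) A = emeasure M (A \<inter> {0..b})"
proof -
  have *: "(\<lambda>t. t) \<in> measurable (restrict_space M {0..b}) borel"
    by (intro measurable_restrict_space1 halfline_measurable[OF sets_M]) simp
  have "emeasure (trunc b) A = emeasure (restrict_space M {0..b}) (A \<inter> {0..b})"
    unfolding trunc_def using assms *
    by (subst emeasure_distr) (auto simp: space_restrict_space halfline_space[OF sets_M] Int_absorb2 vimage_def intro!: arg_cong2[where f = emeasure])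
  also have "\<dots> = emeasure M (A \<inter> {0..b})"
    by (rule emeasure_restrict_space) (auto simp: in_sets_M halfline_space[OF sets_M])
  finally show ?thesis .
qed

lemma finite_borel_measure_trunc: "finite_borel_measure (trunc b)"
proof (intro finite_borel_measure.intro finite_measureI finite_borel_measure_axioms.intro)
  show *: "sets (trunc b) = sets borel" by (simp add: trunc_def)
  from sets_eq_imp_space_eq[OF *] have sp: "space (trunc b) = UNIV" by simp
  show "emeasure (trunc b) (space (trunc b)) \<noteq> \<infinity>"
    using emeasure_trunc[of UNIV b] emeasure_Icc_neq_top[of b] unfolding sp by simp
qed

lemma cdf_trunc: "u \<le> b \<Longrightarrow> cdf (trunc b) u = distribution u"
proof -
  assume "u \<le> b"
  then have "{..u} \<inter> {0..b} = {0..u}" by auto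
  then show ?thesis
    by (simp only: cdf_def distribution_def measure_def emeasure_trunc[OF atMost_borel])
qed

text \<open>Near \<open>t\<close> the function agrees with the \<open>cdf\<close> of the truncation
  at \<open>t + 1\<close>; the extra 1 leaves room to the right of \<open>t\<close>.\<close>

lemma distribution_right_continuous: "continuous (at_right t) distribution"
proof -
  have "continuous (at_right t) (cdf (trunc (t + 1)))"
    by (rule finite_borel_measure.cdf_is_right_cont[OF finite_borel_measure_trunc])
  moreover have "\<forall>\<^sub>F u in at_right t. cdf (trunc (t + 1)) u = distribution u"
    using eventually_at_right[of t "t + 1"] by (auto intro!: exI[of _ "t + 1"] cdf_trunc)
  ultimately show ?thesis
    unfolding continuous_within using cdf_trunc[of t "t + 1"] tendsto_cong by fastforce
qed

lemma distribution_continuous: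
  assumes "measure M {t} = 0" "0 \<le> t"
  shows "isCont distribution t"
proof -
  have "measure (trunc (t + 1)) {t} = 0"
    using emeasure_trunc[of "{t}" "t + 1"] assms by (simp add: measure_def)
  then have "isCont (cdf (trunc (t + 1))) t"
    using finite_borel_measure.isCont_cdf[OF finite_borel_measure_trunc] by blast
  moreover have "\<forall>\<^sub>F u in nhds t. cdf (trunc (t + 1)) u = distribution u"
    by (rule eventually_mono[OF eventually_nhds_in_open[of "{..<t + 1}"]]) (auto intro: cdf_trunc)
  ultimately show ?thesis by (simp add: isCont_cong)
qed

text \<open>The function \<open>distribution\<close> is itself an antiderivative of the measure
  \<open>M\<close>: one factor 1/x comes from that passage, the other \<open>n\<close> from the
  Lebesgue antiderivatives.\<close>

lemma laplace_distribution:
  assumes "x > 0"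
  shows "(\<integral>\<^sup>+t. ennreal (iterated_integral distribution n t) * ennreal (exp (- (x * t))) \<partial>lborel)
    = ennreal ((1 / x) ^ Suc n) * (\<integral>\<^sup>+s. ennreal (exp (- (x * s))) \<partial>M)"
proof -
  have "(\<integral>\<^sup>+s. indicator {..t} s \<partial>M) = ennreal (distribution t)" for t
  proof -
    have "(\<integral>\<^sup>+s. indicator {..t} s \<partial>M) = (\<integral>\<^sup>+s. indicator {0..t} s \<partial>M)"
      using halfline_space[OF sets_M] by (intro nn_integral_cong) (auto split: split_indicator)
    also have "\<dots> = emeasure M {0..t}"
      by (rule nn_integral_indicator) (simp add: in_sets_M)
    finally show ?thesis
      using finite_Icc[of t] by (simp add: distribution_def emeasure_eq_ennreal_measure)
  qed
  then have "(\<integral>\<^sup>+t. ennreal (distribution t) * ennreal (exp (- (x * t))) \<partial>lborel)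
      = ennreal (1 / x) * (\<integral>\<^sup>+s. ennreal (exp (- (x * s))) \<partial>M)"
    using laplace_of_antiderivative[OF sigma_finite halfline_measurable[OF sets_M, of "\<lambda>t. t"], of "\<lambda>_. 1" x] assms
    by simp
  moreover have "(\<integral>\<^sup>+t. ennreal (iterated_integral distribution n t) * ennreal (exp (- (x * t))) \<partial>lborel)
      = ennreal ((1 / x) ^ n) * (\<integral>\<^sup>+t. ennreal (distribution t) * ennreal (exp (- (x * t))) \<partial>lborel)"
    by (rule laplace_iterated_integral[OF distribution_mono distribution_neg assms])
  ultimately show ?thesis
    using assms by (simp add: mult.assoc[symmetric] ennreal_mult[symmetric] mult.commute[of "1 / x"])
qed

text \<open>The top derivative and the initial values determine \<open>p\<close>. One integrates
  downwards from the top: the first step rests on right derivatives, the later ones on the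
  fundamental theorem of calculus.\<close>

lemma nth_deriv_imp_iterated_integral:
  assumes p: "nth_deriv_is_distribution n p M"
    and zero: "\<And>k. k < n \<Longrightarrow> (halfline_deriv ^^ k) p 0 = 0" and "t \<ge> 0"
  shows "p t = iterated_integral distribution n t"
proof (cases n)
  case 0
  then show ?thesis using p \<open>t \<ge> 0\<close> by (simp add: nth_deriv_is_distribution_def distribution_def)
next
  case (Suc m)
  define P where "P k = (halfline_deriv ^^ k) p" for k
  define I where "I = iterated_integral distribution"
  note mn = distribution_mono distribution_neg
  have diff: "\<And>k. k < m \<Longrightarrow> P k differentiable_on {0..}" and cont: "continuous_on {0..} (P m)"
    and right: "\<And>t. t \<ge> 0 \<Longrightarrow> (P m has_real_derivative distribution t) (at t within {t..})"
    using p unfolding Suc nth_deriv_is_distribution_def P_def times_differentiable_halfline_def distribution_def by auto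
  \<comment> \<open>Here \<open>k\<close> counts the steps below order \<open>m\<close>. The index
    on the right is \<open>Suc k\<close> because the derivative of order \<open>m\<close> is already
    one integral of \<open>distribution\<close>.\<close>
  have "P (m - k) t = I (Suc k) t" if "k \<le> m" "t \<ge> 0" for k t
    using that
  proof (induction k arbitrary: t)
    case 0
    have "P m t - I 1 t = P m 0 - I 1 0"
    proof (rule zero_right_derivative_imp_eq[of 0 t "\<lambda>t. P m t - I 1 t"])
      show "continuous_on {0..t} (\<lambda>t. P m t - I 1 t)"
        using continuous_on_subset[OF cont] continuous_on_subset[OF iterated_integral_Suc_continuous[OF mn, of 0]]
        unfolding I_def One_nat_def by (intro continuous_intros) auto
      show "((\<lambda>t. P m t - I 1 t) has_real_derivative 0) (at u within {u..})" if "0 \<le> u" for u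
        using DERIV_diff[OF right[OF that] integral_has_right_derivative[OF mn that distribution_right_continuous]]
        unfolding I_def by simp
    qed (use 0 in auto)
    moreover have "P m 0 = 0" using zero[of m] Suc by (simp add: P_def)
    ultimately show ?case by (simp add: I_def)
  next
    case (Suc k)
    define l where "l = m - Suc k"
    have l: "l < m" "m - k = Suc l" using Suc.prems by (auto simp: l_def)
    have "(P (Suc l) has_integral P l t - P l 0) {0..t}"
    proof (rule fundamental_theorem_of_calculus)
      fix u assume u: "u \<in> {0..t}"
      have "(P l has_real_derivative P (Suc l) u) (at u within {0..})"
        using halfline_deriv_works[OF _ diff[OF l(1)], of u] u by (simp add: P_def)
      then show "(P l has_vector_derivative P (Suc l) u) (at u within {0..t})"
        using has_vector_derivative_within_subset[of "P l" _ u "{0..}" "{0..t}"]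
        by (auto simp: has_real_derivative_iff_has_vector_derivative)
    qed (use Suc.prems in simp)
    moreover have "P l 0 = 0" using zero[of l] l \<open>n = Suc m\<close> by (simp add: P_def)
    ultimately have "P l t = integral {0..t} (P (Suc l))" by (simp add: integral_unique)
    also have "\<dots> = integral {0..t} (I (Suc k))"
      using Suc.IH Suc.prems l by (intro Henstock_Kurzweil_Integration.integral_cong) auto
    finally show ?case by (simp add: I_def l_def)
  qed
  from this[of m t] \<open>t \<ge> 0\<close> show ?thesis by (simp add: P_def I_def Suc)
qed

text \<open>Undoing an integration needs a continuous integrand, and every function obtained by at
  least one integration is continuous. The function \<open>distribution\<close> may jump, so
  \<open>k < n\<close> stops one short of it.\<close>

lemma halfline_deriv_iterated_integral:
  assumes p: "\<And>t. t \<ge> 0 \<Longrightarrow> p t = iterated_integral distribution n t" and "k < n" "t \<ge> 0"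
  shows "(halfline_deriv ^^ k) p t = iterated_integral distribution (n - k) t"
  using assms(2,3)
proof (induction k arbitrary: t)
  case 0
  then show ?case using p by simp
next
  case (Suc k)
  obtain j where j: "n - k = Suc (Suc j)" "n - Suc k = Suc j"
    using Suc.prems by (intro that[of "n - Suc (Suc k)"]) auto
  have "continuous (at t within {0..}) (iterated_integral distribution (Suc j))"
    using iterated_integral_Suc_continuous[OF distribution_mono distribution_neg, of j] Suc.prems
    by (auto simp: continuous_on_eq_continuous_within simp del: iterated_integral.simps)
  from iterated_integral_has_derivative[OF distribution_mono distribution_neg Suc.prems(2) this]
  have "((halfline_deriv ^^ k) p has_real_derivative iterated_integral distribution (Suc j) t) (at t within {0..})"
    by (rule has_real_derivative_cong_on) (use Suc j in auto)
  then show ?case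
    using Suc.prems j by (simp add: halfline_deriv_eq del: iterated_integral.simps)
qed

lemma iterated_integral_imp_nth_deriv:
  assumes p: "\<And>t. t \<ge> 0 \<Longrightarrow> p t = iterated_integral distribution n t"
  shows "nth_deriv_is_distribution n p M" and "\<And>k. k < n \<Longrightarrow> (halfline_deriv ^^ k) p 0 = 0"
proof -
  note mn = distribution_mono distribution_neg
  note D = halfline_deriv_iterated_integral[where p = p and n = n, OF p]
  show "(halfline_deriv ^^ k) p 0 = 0" if "k < n" for k
  proof -
    obtain j where "n - k = Suc j" using \<open>k < n\<close> by (metis Suc_diff_Suc)
    then show ?thesis using D[OF _ that, of 0] by simp
  qed
  show "nth_deriv_is_distribution n p M"
  proof (cases n)
    case 0
    then show ?thesis using p by (simp add: nth_deriv_is_distribution_def distribution_def)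
  next
    case (Suc m)
    have top: "(halfline_deriv ^^ m) p t = iterated_integral distribution (Suc 0) t" if "t \<ge> 0" for t
      using D[OF _ _ that, of m] Suc by simp
    have diff: "(halfline_deriv ^^ k) p differentiable_on {0..}" if "k < m" for k
      unfolding differentiable_on_def
    proof
      fix t :: real assume t: "t \<in> {0..}"
      obtain j where j: "n - k = Suc (Suc j)"
        using \<open>k < m\<close> Suc by (intro that[of "n - Suc (Suc k)"]) auto
      have "continuous (at t within {0..}) (iterated_integral distribution (Suc j))"
        using iterated_integral_Suc_continuous[OF mn, of j] t
        by (auto simp: continuous_on_eq_continuous_within simp del: iterated_integral.simps)
      from iterated_integral_has_derivative[OF mn _ this] t
      have "(iterated_integral distribution (Suc (Suc j)) has_real_derivative
          iterated_integral distribution (Suc j) t) (at t within {0..})" by simp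
      then have "((halfline_deriv ^^ k) p has_real_derivative
          iterated_integral distribution (Suc j) t) (at t within {0..})"
        by (rule has_real_derivative_cong_on) (use t D[of k] j Suc \<open>k < m\<close> in auto)
      then show "(halfline_deriv ^^ k) p differentiable (at t within {0..})"
        using real_differentiable_def by blast
    qed
    have cont: "continuous_on {0..} ((halfline_deriv ^^ m) p)"
      using iterated_integral_Suc_continuous[OF mn, of 0]
      by (rule continuous_on_eq) (use top in auto)
    have right: "((halfline_deriv ^^ m) p has_real_derivative measure M {0..t}) (at t within {t..})" if "t \<ge> 0" for t
      using integral_has_right_derivative[OF mn that distribution_right_continuous]
      unfolding distribution_def[of t, symmetric]
      by (rule has_real_derivative_cong_on) (use top that in auto)
    \<comment> \<open>A point without mass is a continuity point of \<open>distribution\<close>, so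
      there the integral is differentiable within the whole half-line.\<close>
    have two_sided: "((halfline_deriv ^^ m) p has_real_derivative measure M {0..t}) (at t within {0..})"
      if "t \<ge> 0" "measure M {t} = 0" for t
    proof -
      have "continuous (at t within {0..}) (iterated_integral distribution 0)"
        using distribution_continuous[OF that(2,1)] continuous_at_imp_continuous_at_within by auto
      from iterated_integral_has_derivative[OF mn that(1) this]
      have "(iterated_integral distribution (Suc 0) has_real_derivative measure M {0..t}) (at t within {0..})"
        by (simp add: distribution_def[of t])
      then show ?thesis
        by (rule has_real_derivative_cong_on) (use top that in auto)
    qed
    show ?thesis
      unfolding nth_deriv_is_distribution_def Suc
      using diff cont right two_sided by (simp add: times_differentiable_halfline_def)
  qed
qed

end

subsection \<open>The Bernstein--Widder theorem\<close>

text \<open>Lets Taylor series with nonnegative terms be read as expectations under a discrete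
  distribution.\<close>

lemma has_bochner_integral_nat_pmf:
  assumes "\<And>k. 0 \<le> h k" "(\<lambda>k. pmf P k * h k) sums S"
  shows "has_bochner_integral (measure_pmf P) h S"
proof (rule has_bochner_integral_nn_integral)
  show "0 \<le> S" using assms by (intro sums_le[OF _ sums_zero assms(2)]) auto
  have "(\<integral>\<^sup>+k. ennreal (h k) \<partial>measure_pmf P) = (\<Sum>k. ennreal (pmf P k * h k))"
    by (simp add: nn_integral_measure_pmf nn_integral_count_space_nat ennreal_mult' )
  also have "\<dots> = ennreal S"
    using assms by (intro suminf_ennreal_eq) auto
  finally show "(\<integral>\<^sup>+k. ennreal (h k) \<partial>measure_pmf P) = ennreal S" .
qed (use assms in auto)

text \<open>The Taylor series of \<open>g\<close> about \<open>1 + b\<close>, evaluated at \<open>1 + b - b exp (- l / b)\<close>, is the Laplace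
  transform at \<open>l\<close> of a discrete measure on the multiples of \<open>1 / b\<close> (Feller).\<close>

lemma completely_monotonic_discrete_laplace:
  assumes g: "completely_monotonic g" and b: "b > 0"
  obtains c :: "nat \<Rightarrow> real" where "\<And>k. 0 \<le> c k"
    "\<And>l. 0 \<le> l \<Longrightarrow> (\<lambda>k. c k * exp (- (l * (real k / b)))) sums g (1 + b - b * exp (- (l / b)))"
    "(\<lambda>k. c k * (real k / b)) sums (- deriv g 1)"
proof
  define c where "c k = (- 1) ^ k * (deriv ^^ k) g (1 + b) * b ^ k / fact k" for k
  show "0 \<le> c k" for k
    using g b unfolding c_def completely_monotonic_def by simp
  show "(\<lambda>k. c k * exp (- (l * (real k / b)))) sums g (1 + b - b * exp (- (l / b)))" if "0 \<le> l" for l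
  proof -
    have "exp (- (l / b)) \<le> 1" using that b by simp
    then have "b * exp (- (l / b)) \<le> b * 1" using b by (intro mult_left_mono) auto
    then have "0 < 1 + b - b * exp (- (l / b))" by linarith
    then have "(\<lambda>k. (- 1) ^ k * (deriv ^^ k) g (1 + b) * ((1 + b) - (1 + b - b * exp (- (l / b)))) ^ k / fact k)
        sums g (1 + b - b * exp (- (l / b)))"
      using b by (intro completely_monotonic_taylor_sums[OF g]) auto
    moreover have "exp (- (l / b)) ^ k = exp (- (l * (real k / b)))" for k
      by (simp add: exp_of_nat_mult[symmetric])
    ultimately show ?thesis
      by (simp add: c_def power_mult_distrib mult_ac)
  qed
  \<comment> \<open>The factor \<open>real (Suc k)\<close> cancels against the factorial, so the
    first moment is the Taylor series of -g' about \<open>1 + b\<close> at 1. The vanishing term of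
    index 0 is put back by \<open>sums_Suc\<close>.\<close>
  have "c (Suc k) * (real (Suc k) / b) = (- 1) ^ Suc k * (deriv ^^ Suc k) g (1 + b) * (1 + b - 1) ^ k / fact k" for k
    using b unfolding c_def by (simp add: field_simps del: of_nat_Suc)
  then have "(\<lambda>k. c (Suc k) * (real (Suc k) / b)) sums (- deriv g 1)"
    using completely_monotonic_taylor_sums_deriv[OF g, of 1 "1 + b"] b by (simp only:)
  from sums_Suc[OF this] show "(\<lambda>k. c k * (real k / b)) sums (- deriv g 1)" by simp
qed

text \<open>With u = X n standing for 1/b, the expression is 1 plus the difference quotient of - exp
  (- l u) at u = 0. So the evaluation points of the discrete transforms tend to 1 + l.\<close>

lemma tendsto_scaled_exp_diff:
  assumes "X \<longlonglongrightarrow> 0" "\<And>n. X n > (0 :: real)"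
  shows "(\<lambda>n. 1 + 1 / X n - 1 / X n * exp (- (l / (1 / X n)))) \<longlonglongrightarrow> 1 + l"
proof -
  have "((\<lambda>u. - exp (- (l * u))) has_real_derivative l) (at 0)"
    by (auto intro!: derivative_eq_intros)
  then have "((\<lambda>u. (- exp (- (l * u)) + 1) / u) \<longlongrightarrow> l) (at 0)"
    by (simp add: has_field_derivative_iff)
  moreover have "filterlim X (at 0) sequentially"
    using assms by (intro filterlim_atI) (auto intro!: always_eventually simp: less_imp_neq[THEN not_sym])
  ultimately have "(\<lambda>n. (- exp (- (l * X n)) + 1) / X n) \<longlonglongrightarrow> l"
    by (rule filterlim_compose)
  from tendsto_add[OF tendsto_const[of 1] this] show ?thesis
    by (simp add: diff_divide_distrib add_divide_distrib add_diff_eq)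
qed

text \<open>Dividing by \<open>g 1\<close> produces probability measures, and starting at 1 keeps
  the kernels bounded on the half-line, as weak convergence requires.\<close>

lemma completely_monotonic_laplace_atLeast_1:
  assumes g: "completely_monotonic g"
  obtains \<nu> where "real_distribution \<nu>" "AE t in \<nu>. 0 \<le> t"
    "\<And>x. x \<ge> 1 \<Longrightarrow> g x = g 1 * (\<integral>t. exp (- ((x - 1) * t)) \<partial>\<nu>)"
proof -
  have sign: "0 \<le> (- 1) ^ n * (deriv ^^ n) g x" if "x > 0" for n x
    using g that unfolding completely_monotonic_def by blast
  have deriv: "(g has_real_derivative deriv g x) (at x)" if "x > 0" for x
    using completely_monotonic_has_derivative[OF g that, of 0] by simp
  consider "g 1 = 0" | "g 1 > 0" using sign[of 1 0] by fastforce
  then show thesis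
  proof cases
    case 1
    \<comment> \<open>Being nonnegative and nonincreasing, \<open>g\<close> vanishes from 1 on. Any
      distribution on the half-line then serves; the point mass at 0 is taken.\<close>
    have "g x = 0" if "x \<ge> 1" for x :: real
    proof -
      have "g x \<le> g 1"
      proof (rule DERIV_nonpos_imp_nonincreasing[OF that])
        fix y :: real assume "1 \<le> y"
        then show "\<exists>D. (g has_real_derivative D) (at y) \<and> D \<le> 0"
          using deriv[of y] sign[of y 1] by (intro exI[of _ "deriv g y"]) auto
      qed
      then show ?thesis using 1 sign[of x 0] that by simp
    qed
    then show thesis
      using 1 by (intro that[of "return borel 0"])
        (auto simp: real_distribution_def real_distribution_axioms_def AE_return intro!: prob_space_return)
  next
    case 2
    define b where "b n = real (Suc n)" for n
    have b: "b n > 0" for n by (simp add: b_def)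
    define represents where "represents n c \<longleftrightarrow> (\<forall>k. 0 \<le> c k) \<and>
      (\<forall>l\<ge>0. (\<lambda>k. c k * exp (- (l * (real k / b n)))) sums g (1 + b n - b n * exp (- (l / b n)))) \<and>
      (\<lambda>k. c k * (real k / b n)) sums (- deriv g 1)" for n c
    have "\<exists>c. represents n c" for n
      by (rule completely_monotonic_discrete_laplace[OF g b[of n]]) (unfold represents_def, blast)
    then obtain c where "\<And>n. represents n (c n)" by metis
    then have c: "\<And>n k. 0 \<le> c n k"
      "\<And>n l. l \<ge> 0 \<Longrightarrow> (\<lambda>k. c n k * exp (- (l * (real k / b n)))) sums g (1 + b n - b n * exp (- (l / b n)))"
      "\<And>n. (\<lambda>k. c n k * (real k / b n)) sums (- deriv g 1)"
      unfolding represents_def by auto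
    define P where "P n = embed_pmf (\<lambda>k. c n k / g 1)" for n
    have P: "pmf (P n) k = c n k / g 1" for n k
    proof -
      have "(\<lambda>k. c n k / g 1) sums (g 1 / g 1)"
        using sums_divide[OF c(2)[of 0 n], of "g 1"] by simp
      then have "(\<integral>\<^sup>+k. ennreal (c n k / g 1) \<partial>count_space UNIV) = 1"
        using c(1) 2 by (simp add: nn_integral_count_space_nat suminf_ennreal_eq sums_iff)
      then show ?thesis unfolding P_def using c(1) 2 by (intro pmf_embed_pmf) auto
    qed
    define \<nu> where "\<nu> n = distr (measure_pmf (P n)) borel (\<lambda>k. real k / b n)" for n
    have dist: "real_distribution (\<nu> n)" for n
      unfolding \<nu>_def by (intro prob_space.real_distribution_distr) (auto intro: measure_pmf.prob_space_axioms)
    have bochner: "has_bochner_integral (\<nu> n) h (S / g 1)"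
      if "h \<in> borel_measurable borel" "\<And>t. 0 \<le> h t" "(\<lambda>k. c n k * h (real k / b n)) sums S" for h n S
      unfolding \<nu>_def using that sums_divide[OF that(3), of "g 1"]
      by (intro has_bochner_integral_distr has_bochner_integral_nat_pmf) (auto simp: P)
    have supp: "AE t in \<nu> n. 0 \<le> t" for n
      unfolding \<nu>_def using b[of n] by (subst AE_distr_iff) (auto intro!: AE_I2)
    have "tight \<nu>"
      unfolding tight_def
    proof (intro conjI allI impI dist)
      fix \<epsilon> :: real assume \<epsilon>: "\<epsilon> > 0"
      \<comment> \<open>The common first moment of all \<open>\<nu> n\<close>. Markov's inequality
        bounds the mass beyond \<open>T\<close> by \<open>m / T\<close>; the \<open>+ 1\<close> in
        \<open>T\<close> makes \<open>T\<close> positive and this bound strictly smaller than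
        \<open>\<epsilon>\<close>.\<close>
      define m where "m = - deriv g 1 / g 1"
      have m: "m \<ge> 0" unfolding m_def using sign[of 1 1] 2 by (simp add: divide_nonpos_pos)
      define T where "T = (m + 1) / \<epsilon>"
      have T: "T > 0" unfolding T_def using m \<epsilon> by simp
      \<comment> \<open>The interval is open on the left, so it starts at -1 in order to keep a
        possible atom at 0.\<close>
      have mass: "1 - \<epsilon> < measure (\<nu> n) {- 1<..T}" for n
      proof -
        interpret real_distribution "\<nu> n" by (rule dist)
        have "has_bochner_integral (\<nu> n) (\<lambda>t. \<bar>t\<bar>) m"
          unfolding m_def using c(3)[of n] b[of n] by (intro bochner) (auto simp: abs_div)
        then have int: "integrable (\<nu> n) (\<lambda>t. \<bar>t\<bar>)" "(\<integral>t. \<bar>t\<bar> \<partial>\<nu> n) = m"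
          by (auto simp: has_bochner_integral_iff)
        have "prob {t \<in> space (\<nu> n). T \<le> \<bar>t\<bar>} \<le> m / T"
          using integral_Markov_inequality_measure[OF int(1), of UNIV T] T int(2) by simp
        also have "\<dots> < \<epsilon>"
          using T \<epsilon> m unfolding T_def by (simp add: field_simps)
        finally have small: "prob {t. T \<le> \<bar>t\<bar>} < \<epsilon>" by simp
        have "1 - prob {- 1<..T} = prob (UNIV - {- 1<..T})"
          using prob_compl[of "{- 1<..T}"] by simp
        also have "\<dots> \<le> prob {t. T \<le> \<bar>t\<bar>}"
          using supp[of n] by (intro finite_measure_mono_AE) auto
        finally show "1 - \<epsilon> < prob {- 1<..T}" using small by simp
      qed
      show "\<exists>a b. a < b \<and> (\<forall>n. 1 - \<epsilon> < measure (\<nu> n) {a<..b})"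
        by (rule exI[of _ "- 1"], rule exI[of _ T]) (use T mass in auto)
    qed
    from tight_imp_convergent_subsubsequence[OF this, of id] obtain r \<mu>
      where r: "strict_mono r" and \<mu>: "real_distribution \<mu>" and conv: "weak_conv_m (\<nu> \<circ> r) \<mu>"
      by (auto simp: strict_mono_id)
    interpret \<mu>: real_distribution \<mu> by (rule \<mu>)
    have lim: "(\<lambda>n. \<integral>t. h t \<partial>\<nu> (r n)) \<longlonglongrightarrow> (\<integral>t. h t \<partial>\<mu>)"
      if "\<And>t. isCont h t" "\<And>t. \<bar>h t\<bar> \<le> 1" for h :: "real \<Rightarrow> real"
      using weak_conv_imp_integral_bdd_continuous_conv[OF _ \<mu> conv, of h 1] that dist by (simp add: comp_def)
    have AE: "AE t in \<mu>. 0 \<le> t"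
    proof -
      \<comment> \<open>A bounded continuous test function that is positive exactly on the
        negatives: its zero integral survives the weak limit and excludes mass there.\<close>
      define h :: "real \<Rightarrow> real" where "h t = max 0 (min 1 (- t))" for t
      have h: "isCont h t" "\<bar>h t\<bar> \<le> 1" for t
        unfolding h_def by (auto intro!: continuous_intros)
      have [measurable]: "h \<in> borel_measurable borel" unfolding h_def by measurable
      have "(\<integral>t. h t \<partial>\<nu> n) = 0" for n
      proof -
        have "AE t in \<nu> n. h t = 0" using supp[of n] by eventually_elim (simp add: h_def)
        then show ?thesis by (rule integral_eq_zero_AE)
      qed
      with lim[OF h] have "(\<integral>t. h t \<partial>\<mu>) = 0" by (simp add: LIMSEQ_const_iff)
      moreover have "integrable \<mu> h"
        using h by (intro \<mu>.integrable_const_bound[of _ 1]) auto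
      ultimately have "AE t in \<mu>. h t = 0"
        by (subst (asm) integral_nonneg_eq_0_iff_AE) (auto simp: h_def)
      then show ?thesis by eventually_elim (auto simp: h_def max_def min_def split: if_splits)
    qed
    have "g x = g 1 * (\<integral>t. exp (- ((x - 1) * t)) \<partial>\<mu>)" if x: "x \<ge> 1" for x
    proof -
      define l where "l = x - 1"
      \<comment> \<open>The \<open>max\<close> makes the kernel bounded on the whole line and
        changes nothing where the measures live.\<close>
      define h where "h t = exp (- (l * max 0 t))" for t
      have l: "l \<ge> 0" using x by (simp add: l_def)
      have h: "isCont h t" "\<bar>h t\<bar> \<le> 1" for t
        unfolding h_def using l by (auto intro!: continuous_intros)
      have [measurable]: "h \<in> borel_measurable borel" unfolding h_def by measurable
      have "(\<integral>t. h t \<partial>\<nu> n) = g (1 + b n - b n * exp (- (l / b n))) / g 1" for n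
      proof -
        have "has_bochner_integral (\<nu> n) h (g (1 + b n - b n * exp (- (l / b n))) / g 1)"
          using c(2)[OF l, of n] b[of n] by (intro bochner) (auto simp: h_def)
        then show ?thesis by (simp add: has_bochner_integral_iff)
      qed
      with lim[OF h] have "(\<lambda>n. g (1 + b (r n) - b (r n) * exp (- (l / b (r n)))) / g 1) \<longlonglongrightarrow> (\<integral>t. h t \<partial>\<mu>)"
        by simp
      moreover have "(\<lambda>n. g (1 + b (r n) - b (r n) * exp (- (l / b (r n)))) / g 1) \<longlonglongrightarrow> g x / g 1"
      proof -
        have "(\<lambda>n. 1 / b (r n)) \<longlonglongrightarrow> 0"
          using LIMSEQ_subseq_LIMSEQ[OF LIMSEQ_inverse_real_of_nat r]
          by (simp add: comp_def b_def inverse_eq_divide)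
        from tendsto_scaled_exp_diff[OF this, of l]
        have "(\<lambda>n. 1 + b (r n) - b (r n) * exp (- (l / b (r n)))) \<longlonglongrightarrow> x"
          using b by (simp add: l_def)
        moreover have "isCont g x" using deriv[of x] x by (intro DERIV_isCont) auto
        ultimately show ?thesis
          using 2 by (intro tendsto_divide tendsto_const isCont_tendsto_compose[of x g]) auto
      qed
      ultimately have "(\<integral>t. h t \<partial>\<mu>) = g x / g 1" by (rule LIMSEQ_unique)
      moreover have "(\<integral>t. h t \<partial>\<mu>) = (\<integral>t. exp (- (l * t)) \<partial>\<mu>)"
      proof (rule integral_cong_AE)
        show "AE t in \<mu>. h t = exp (- (l * t))"
          using AE by eventually_elim (simp add: h_def max_def)
      qed simp_all
      ultimately show ?thesis using 2 by (simp add: l_def)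
    qed
    then show thesis using that[OF \<mu> AE] by blast
  qed
qed

text \<open>The representation on \<open>[1, \<infinity>)\<close> extends to \<open>(0, \<infinity>)\<close>: expand \<open>g\<close> about \<open>2\<close>, where its derivatives are
  moments of \<open>exp (- 2 t) dM\<close>, and sum under the integral by monotone convergence.\<close>

lemma laplace_extend:
  assumes g: "completely_monotonic g" and M: "sets M = sets (restrict_space borel {0..})"
    and L: "\<And>x. x > 1 \<Longrightarrow> (\<integral>\<^sup>+t. ennreal (exp (- (x * t))) \<partial>M) = ennreal (g x)" and x: "x > 0"
  shows "(\<integral>\<^sup>+t. ennreal (exp (- (x * t))) \<partial>M) = ennreal (g x)"
proof (cases "x > 1")
  case True
  then show ?thesis by (rule L)
next
  case False
  have nonneg: "0 \<le> g y" if "y > 0" for y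
    using g that unfolding completely_monotonic_def by (metis funpow_0 mult_1 power_0)
  note B = laplace_integral_of_nn_integral[OF M L nonneg]
  \<comment> \<open>The terms of \<open>exp (- (2 * t))\<close> times the series of
    \<open>exp ((2 - x) * t)\<close>, all nonnegative since \<open>x\<close> is at most 1 here. The
    centre 2 lies inside the range where the transform is known, so the moments are derivatives of
    \<open>g\<close> at 2.\<close>
  define \<phi> where "\<phi> k t = t ^ k * exp (- (2 * t)) * (2 - x) ^ k / fact k" for k t
  have \<phi>_nonneg: "AE t in M. 0 \<le> \<phi> k t" for k
    using halfline_space[OF M] False by (intro AE_I2) (auto simp: \<phi>_def)
  have [measurable]: "\<phi> k \<in> borel_measurable M" for k
    unfolding \<phi>_def by (rule halfline_measurable[OF M]) simp
  have int: "integrable M (\<lambda>t. (- t) ^ k * exp (- (2 * t)))" for k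
    using B by (intro integrable_power_laplace[OF M, of 1]) auto
  have \<phi>_eq: "\<phi> k t = ((- 1) ^ k * ((2 - x) ^ k / fact k)) * ((- t) ^ k * exp (- (2 * t)))" for k t
    using power_mult_distrib[of "- 1" "- t" k] by (simp add: \<phi>_def)
  have "integrable M (\<phi> k)" for k
    unfolding \<phi>_eq by (intro integrable_mult_right int)
  moreover have "(\<integral>t. \<phi> k t \<partial>M) = (- 1) ^ k * (deriv ^^ k) g 2 * (2 - x) ^ k / fact k" for k
    using iterated_deriv_laplace[OF M, of 1 g 2 k] B unfolding \<phi>_eq by simp
  ultimately have moment: "(\<integral>\<^sup>+t. ennreal (\<phi> k t) \<partial>M) = ennreal ((- 1) ^ k * (deriv ^^ k) g 2 * (2 - x) ^ k / fact k)" for k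
    using nn_integral_eq_integral[OF _ \<phi>_nonneg] by simp
  have exp_sums: "\<phi> k t \<ge> 0" "(\<lambda>k. \<phi> k t) sums exp (- (x * t))" if "t \<in> space M" for t k
  proof -
    show "\<phi> k t \<ge> 0" using that halfline_space[OF M] False by (auto simp: \<phi>_def)
    have "(\<lambda>k. exp (- (2 * t)) * (((2 - x) * t) ^ k /\<^sub>R fact k)) sums (exp (- (2 * t)) * exp ((2 - x) * t))"
      by (intro sums_mult exp_converges)
    also have "exp (- (2 * t)) * exp ((2 - x) * t) = exp (- (x * t))"
      by (simp add: exp_add[symmetric] algebra_simps)
    also have "(\<lambda>k. exp (- (2 * t)) * (((2 - x) * t) ^ k /\<^sub>R fact k)) = (\<lambda>k. \<phi> k t)"
      by (simp add: \<phi>_def fun_eq_iff power_mult_distrib divide_inverse mult_ac)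
    finally show "(\<lambda>k. \<phi> k t) sums exp (- (x * t))" .
  qed
  have "(\<integral>\<^sup>+t. ennreal (exp (- (x * t))) \<partial>M) = (\<integral>\<^sup>+t. (\<Sum>k. ennreal (\<phi> k t)) \<partial>M)"
    using exp_sums by (intro nn_integral_cong suminf_ennreal_eq[symmetric]) auto
  also have "\<dots> = (\<Sum>k. \<integral>\<^sup>+t. ennreal (\<phi> k t) \<partial>M)"
    by (rule nn_integral_suminf) simp
  also have "\<dots> = ennreal (g x)"
    unfolding moment
  proof (rule suminf_ennreal_eq)
    show "0 \<le> (- 1) ^ k * (deriv ^^ k) g 2 * (2 - x) ^ k / fact k" for k
      using g False unfolding completely_monotonic_def by simp
    show "(\<lambda>k. (- 1) ^ k * (deriv ^^ k) g 2 * (2 - x) ^ k / fact k) sums g x"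
      using x False by (intro completely_monotonic_taylor_sums[OF g]) auto
  qed
  finally show ?thesis .
qed

theorem Bernstein_Widder:
  assumes g: "completely_monotonic g"
  obtains M where "halfline_measure M"
    "\<And>x. x > 0 \<Longrightarrow> (\<integral>\<^sup>+t. ennreal (exp (- (x * t))) \<partial>M) = ennreal (g x)"
proof -
  obtain \<nu> where \<nu>: "real_distribution \<nu>" "AE t in \<nu>. 0 \<le> t"
    "\<And>x. x \<ge> 1 \<Longrightarrow> g x = g 1 * (\<integral>t. exp (- ((x - 1) * t)) \<partial>\<nu>)"
    using completely_monotonic_laplace_atLeast_1[OF g] by metis
  interpret real_distribution \<nu> by fact
  have g1: "0 \<le> g 1"
    using g unfolding completely_monotonic_def by (metis funpow_0 mult_1 power_0 zero_less_one)
  \<comment> \<open>The weight \<open>exp t\<close> turns the kernel at \<open>x - 1\<close> into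
    the kernel at \<open>x\<close>, and \<open>g 1\<close> undoes the normalisation. Restriction to
    the half-line discards only a null set.\<close>
  define M where "M = restrict_space (density \<nu> (\<lambda>t. ennreal (g 1 * exp t))) {0..}"
  have M: "sets M = sets (restrict_space borel {0..})"
    unfolding M_def by (intro sets_restrict_space_cong) simp
  have L: "(\<integral>\<^sup>+t. ennreal (exp (- (x * t))) \<partial>M) = ennreal (g x)" if "x > 1" for x
  proof -
    have "(\<integral>\<^sup>+t. ennreal (exp (- (x * t))) \<partial>M)
        = (\<integral>\<^sup>+t. ennreal (g 1 * exp t) * (ennreal (exp (- (x * t))) * indicator {0..} t) \<partial>\<nu>)"
      unfolding M_def by (subst nn_integral_restrict_space) (simp_all add: nn_integral_density)
    also have "\<dots> = (\<integral>\<^sup>+t. ennreal (g 1) * ennreal (exp (- ((x - 1) * t))) \<partial>\<nu>)"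
    proof (rule nn_integral_cong_AE)
      show "AE t in \<nu>. ennreal (g 1 * exp t) * (ennreal (exp (- (x * t))) * indicator {0..} t)
          = ennreal (g 1) * ennreal (exp (- ((x - 1) * t)))"
        using \<nu>(2)
      proof eventually_elim
        fix t :: real assume "0 \<le> t"
        moreover have "exp (- ((x - 1) * t)) = exp t * exp (- (x * t))"
          by (simp add: exp_add[symmetric] algebra_simps)
        ultimately show "ennreal (g 1 * exp t) * (ennreal (exp (- (x * t))) * indicator {0..} t)
          = ennreal (g 1) * ennreal (exp (- ((x - 1) * t)))"
          using g1 by (simp add: ennreal_mult mult.assoc)
      qed
    qed
    also have "\<dots> = ennreal (g 1) * (\<integral>\<^sup>+t. ennreal (exp (- ((x - 1) * t))) \<partial>\<nu>)"
      by (rule nn_integral_cmult) simp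
    also have "(\<integral>\<^sup>+t. ennreal (exp (- ((x - 1) * t))) \<partial>\<nu>) = ennreal (\<integral>t. exp (- ((x - 1) * t)) \<partial>\<nu>)"
    proof (rule nn_integral_eq_integral)
      show "integrable \<nu> (\<lambda>t. exp (- ((x - 1) * t)))"
        using \<nu>(2) that by (intro integrable_const_bound[of _ 1]) (auto elim: eventually_mono)
    qed simp
    finally show ?thesis
      using \<nu>(3)[of x] that g1 by (simp add: ennreal_mult)
  qed
  have L': "(\<integral>\<^sup>+t. ennreal (exp (- (x * t))) \<partial>M) = ennreal (g x)" if "x > 0" for x
    using laplace_extend[OF g M L that] .
  have "halfline_measure M"
  proof
    show "sets M = sets (restrict_space borel {0..})" by (rule M)
    show "emeasure M {0..b} < \<infinity>" for b
    proof -
      have "{0..b} \<in> sets M" unfolding M by (subst sets_restrict_space_iff) auto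
      then have "emeasure M {0..b} = (\<integral>\<^sup>+t. indicator {0..b} t \<partial>M)" by simp
      \<comment> \<open>On [0, b] the function exp (b - t) is at least 1, so the mass is at most exp
        b times the transform at 1.\<close>
      also have "\<dots> \<le> (\<integral>\<^sup>+t. ennreal (exp b) * ennreal (exp (- (1 * t))) \<partial>M)"
      proof (rule nn_integral_mono)
        fix t
        show "indicator {0..b} t \<le> ennreal (exp b) * ennreal (exp (- (1 * t)))"
          by (auto simp: exp_add[symmetric] simp flip: ennreal_mult split: split_indicator)
      qed
      also have "\<dots> = ennreal (exp b) * (\<integral>\<^sup>+t. ennreal (exp (- (1 * t))) \<partial>M)"
        by (intro nn_integral_cmult measurable_compose[OF _ measurable_ennreal] halfline_measurable[OF M]) simp
      also have "\<dots> < \<infinity>"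
        unfolding L'[OF zero_less_one] by (simp add: ennreal_mult_less_top)
      finally show ?thesis .
    qed
  qed
  then show thesis using that L' by blast
qed

section \<open>Radon regularity\<close>

text \<open>Finite Borel measures on the line are inner regular, in particular every truncation.
  Continuity from below along the sets \<open>B \<inter> {0..real n}\<close> passes this on to
  \<open>M\<close>.\<close>

lemma (in halfline_measure) radon: "radon_measure_halfline M"
proof -
  have mono: "emeasure M A \<le> emeasure M B" if "A \<subseteq> B" "A \<in> sets borel" "B \<in> sets borel" "B \<subseteq> {0..}" for A B
    using that by (intro emeasure_mono) (auto simp: in_sets_M)
  have "emeasure M K < \<infinity>" if K: "compact K" "K \<subseteq> {0..}" for K
  proof -
    obtain b where "\<And>t. t \<in> K \<Longrightarrow> norm t \<le> b"
      using compact_imp_bounded[OF K(1)] unfolding bounded_iff by blast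
    then have "K \<subseteq> {0..b}" using K(2) by fastforce
    then have "emeasure M K \<le> emeasure M {0..b}"
      using K(1) by (intro mono) (auto simp: borel_compact)
    also have "\<dots> < \<infinity>" by (rule finite_Icc)
    finally show ?thesis .
  qed
  moreover have "emeasure M B = (SUP K\<in>{K. K \<subseteq> B \<and> compact K}. emeasure M K)" if "B \<in> sets M" for B
  proof (rule antisym)
    have B: "B \<subseteq> {0..}" "B \<in> sets borel" using that by (auto simp: in_sets_M)
    have "(\<Union>n. B \<inter> {0..real n}) = B" using B real_arch_simple by fastforce
    moreover have "(SUP n. emeasure M (B \<inter> {0..real n})) = emeasure M (\<Union>n. B \<inter> {0..real n})"
      using B by (intro SUP_emeasure_incseq) (auto simp: in_sets_M incseq_def)
    ultimately have "emeasure M B = (SUP n. emeasure M (B \<inter> {0..real n}))" by simp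
    also have "\<dots> \<le> (SUP K\<in>{K. K \<subseteq> B \<and> compact K}. emeasure M K)"
    proof (rule SUP_least)
      fix n
      interpret T: finite_borel_measure "trunc (real n)" by (rule finite_borel_measure_trunc)
      have "emeasure M (B \<inter> {0..real n}) = emeasure (trunc (real n)) B"
        by (rule emeasure_trunc[OF B(2), symmetric])
      also have "\<dots> = (SUP K\<in>{K. K \<subseteq> B \<and> compact K}. emeasure (trunc (real n)) K)"
        by (rule inner_regular[OF T.M_is_borel _ B(2)]) (use T.emeasure_finite in simp)
      also have "\<dots> \<le> (SUP K\<in>{K. K \<subseteq> B \<and> compact K}. emeasure M K)"
      proof (rule SUP_mono)
        fix K assume K: "K \<in> {K. K \<subseteq> B \<and> compact K}"
        then have "emeasure (trunc (real n)) K \<le> emeasure M K"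
          using B by (subst emeasure_trunc) (auto intro!: mono simp: borel_compact)
        then show "\<exists>K'\<in>{K. K \<subseteq> B \<and> compact K}. emeasure (trunc (real n)) K \<le> emeasure M K'"
          using K by blast
      qed
      finally show "emeasure M (B \<inter> {0..real n}) \<le> (SUP K\<in>{K. K \<subseteq> B \<and> compact K}. emeasure M K)" .
    qed
    finally show "emeasure M B \<le> (SUP K\<in>{K. K \<subseteq> B \<and> compact K}. emeasure M K)" .
    show "(SUP K\<in>{K. K \<subseteq> B \<and> compact K}. emeasure M K) \<le> emeasure M B"
      using B by (intro SUP_least mono) (auto simp: borel_compact)
  qed
  ultimately show ?thesis
    unfolding radon_measure_halfline_def using sets_M by blast
qed

lemma radon_imp_halfline_measure:
  assumes "radon_measure_halfline M"
  shows "halfline_measure M"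
  using assms unfolding radon_measure_halfline_def by unfold_locales auto

section \<open>The characterisation for general \<open>r\<close>\<close>

theorem theorem1p3:
  fixes r :: nat and f :: "real \<Rightarrow> real"
  assumes "r \<ge> 1"
  shows "completely_monotonic (\<lambda>x. x ^ r * f x) \<longleftrightarrow>
    (\<exists>(p :: real \<Rightarrow> real) (M :: real measure).
       radon_measure_halfline M \<and>
       nth_deriv_is_distribution (r - 1) p M \<and>
       (\<forall>k. k + 2 \<le> r \<longrightarrow> (halfline_deriv ^^ k) p 0 = 0) \<and>
       (\<forall>x>0. ((\<lambda>t. exp (- (x * t)) * p t) has_integral f x) {0..}))"
proof
  assume cm: "completely_monotonic (\<lambda>x. x ^ r * f x)"
  obtain M where M: "halfline_measure M"
    and L: "\<And>x. x > 0 \<Longrightarrow> (\<integral>\<^sup>+t. ennreal (exp (- (x * t))) \<partial>M) = ennreal (x ^ r * f x)"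
    using Bernstein_Widder[OF cm] by metis
  interpret halfline_measure M by fact
  note mn = distribution_mono distribution_neg
  define p where "p = iterated_integral distribution (r - 1)"
  have p_nonneg: "0 \<le> p t" for t unfolding p_def by (rule iterated_integral_nonneg[OF mn])
  have [measurable]: "p \<in> borel_measurable borel" unfolding p_def by (rule iterated_integral_measurable[OF mn])
  have "((\<lambda>t. exp (- (x * t)) * p t) has_integral f x) {0..}" if x: "x > 0" for x
  proof -
    have "0 \<le> x ^ r * f x"
      using cm x unfolding completely_monotonic_def by (metis (no_types, lifting) funpow_0 mult_1 power_0)
    then have f: "0 \<le> f x" using x zero_less_power[OF x, of r] by (simp add: zero_le_mult_iff)
    have "(\<integral>\<^sup>+t. ennreal (exp (- (x * t)) * p t) \<partial>lborel) = (\<integral>\<^sup>+t. ennreal (p t) * ennreal (exp (- (x * t))) \<partial>lborel)"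
      using p_nonneg by (simp add: ennreal_mult mult.commute)
    also have "\<dots> = ennreal ((1 / x) ^ Suc (r - 1)) * ennreal (x ^ r * f x)"
      unfolding p_def laplace_distribution[OF x] L[OF x] ..
    also have "\<dots> = ennreal (f x)"
      using x f assms by (simp add: ennreal_mult[symmetric] power_divide del: power_Suc)
    finally have "((\<lambda>t. exp (- (x * t)) * p t) has_integral f x) UNIV"
      using p_nonneg f by (intro nn_integral_has_integral) auto
    \<comment> \<open>Since \<open>p\<close> vanishes on the negatives, integrals over the line and
      over the half-line coincide.\<close>
    moreover have "(\<lambda>t. if t \<in> {0..} then exp (- (x * t)) * p t else 0) = (\<lambda>t. exp (- (x * t)) * p t)"
      using iterated_integral_neg[OF mn] by (auto simp: p_def fun_eq_iff)
    ultimately have "((\<lambda>t. if t \<in> {0..} then exp (- (x * t)) * p t else 0) has_integral f x) UNIV"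
      by (simp only:)
    then show ?thesis by (simp only: has_integral_restrict_UNIV)
  qed
  moreover note iterated_integral_imp_nth_deriv[of p "r - 1"]
  ultimately show "\<exists>p M. radon_measure_halfline M \<and> nth_deriv_is_distribution (r - 1) p M \<and>
       (\<forall>k. k + 2 \<le> r \<longrightarrow> (halfline_deriv ^^ k) p 0 = 0) \<and>
       (\<forall>x>0. ((\<lambda>t. exp (- (x * t)) * p t) has_integral f x) {0..})"
    using radon by (intro exI[of _ p] exI[of _ M]) (auto simp: p_def)
next
  assume "\<exists>p M. radon_measure_halfline M \<and> nth_deriv_is_distribution (r - 1) p M \<and>
       (\<forall>k. k + 2 \<le> r \<longrightarrow> (halfline_deriv ^^ k) p 0 = 0) \<and>
       (\<forall>x>0. ((\<lambda>t. exp (- (x * t)) * p t) has_integral f x) {0..})"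
  then obtain p M where M: "radon_measure_halfline M" and p: "nth_deriv_is_distribution (r - 1) p M"
    and zero: "\<And>k. k + 2 \<le> r \<Longrightarrow> (halfline_deriv ^^ k) p 0 = 0"
    and int: "\<And>x. x > 0 \<Longrightarrow> ((\<lambda>t. exp (- (x * t)) * p t) has_integral f x) {0..}"
    by blast
  interpret halfline_measure M by (rule radon_imp_halfline_measure[OF M])
  note mn = distribution_mono distribution_neg
  \<comment> \<open>Nothing is known of \<open>p\<close> at negative arguments. The function
    \<open>q\<close> agrees with it on the half-line and vanishes on the negatives, so it can be
    integrated over the whole line.\<close>
  define q where "q = iterated_integral distribution (r - 1)"
  have pq: "p t = q t" if "t \<ge> 0" for t
    unfolding q_def by (rule nth_deriv_imp_iterated_integral[OF p _ that]) (auto intro: zero)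
  have q_nonneg: "0 \<le> q t" for t unfolding q_def by (rule iterated_integral_nonneg[OF mn])
  \<comment> \<open>The sign has to be known before passing to \<open>ennreal\<close>, which sends
    negative numbers to 0.\<close>
  have f: "0 \<le> f x" if "x > 0" for x
    using has_integral_nonneg[OF int[OF that]] pq q_nonneg by auto
  have "(\<integral>\<^sup>+t. ennreal (exp (- (x * t))) \<partial>M) = ennreal (x ^ r * f x)" if x: "x > 0" for x
  proof -
    have "ennreal (f x) = (\<integral>\<^sup>+t. ennreal (exp (- (x * t)) * p t) * indicator {0..} t \<partial>lborel)"
      using nn_integral_has_integral_lebesgue'[OF _ int[OF x]] pq q_nonneg by auto
    also have "\<dots> = (\<integral>\<^sup>+t. ennreal (q t) * ennreal (exp (- (x * t))) \<partial>lborel)"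
      using pq q_nonneg iterated_integral_neg[OF mn]
      by (intro nn_integral_cong) (auto simp: q_def ennreal_mult mult.commute split: split_indicator)
    also have "\<dots> = ennreal ((1 / x) ^ r) * (\<integral>\<^sup>+t. ennreal (exp (- (x * t))) \<partial>M)"
      using laplace_distribution[OF x, of "r - 1"] assms unfolding q_def by simp
    finally have "ennreal (x ^ r) * ennreal (f x)
        = ennreal (x ^ r) * ennreal ((1 / x) ^ r) * (\<integral>\<^sup>+t. ennreal (exp (- (x * t))) \<partial>M)"
      by (simp add: mult.assoc)
    also have "ennreal (x ^ r) * ennreal ((1 / x) ^ r) = 1"
      using x by (simp add: ennreal_mult[symmetric] power_mult_distrib[symmetric])
    finally show ?thesis using x f[OF x] by (simp add: ennreal_mult)
  qed
  from completely_monotonic_laplace[OF sets_M this] show "completely_monotonic (\<lambda>x. x ^ r * f x)"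
    using f by simp
qed

end
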